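(* Let $I\subset\mathbb{R}$ be an open interval, let $A_1,A_2:I\to(0,\infty)$ be smooth functions, and consider on $I\times S^3$ the Riemannian metric $$g=dt^2+A_1^2(t)(e^1)^2+A_2^2(t)\big((e^2)^2+(e^3)^2\big).$$ Suppose that $g$ is Ricci-flat, that $A_1$ and $A_2$ do not coincide, and that there are real constants $k_1,k_2,k_3,l_1,l_2,l_3$ such that $$A_1'=k_1\Big(\frac{A_1}{A_2}\Big)^2+k_2\frac{A_1}{A_2}+k_3,\qquad A_2'=l_1\Big(\frac{A_1}{A_2}\Big)^2+l_2\frac{A_1}{A_2}+l_3 .$$ Then, up to replacing $(k_1,k_2,k_3,l_1,l_2,l_3)$ by $(-k_1,-k_2,-k_3,-l_1,-l_2,-l_3)$, one of the following cases holds: 1. $k_1=1$, $k_2=k_3=l_1=0$, $l_2=-1$, $l_3=2$, and the metric $g$ is isometric to the Taub-NUT metric; 2. $k_1=1$, $k_2=0$, $k_3=-2$, $l_1=0$, $l_2=-1$, $l_3=0$, and the metric $g$ is isometric to the Eguchi-Hanson metric; 3. $k_1=1$, $k_2=k_3=l_1=0$, $l_2=-1$, $l_3=-2$.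
   Context: $S^3$ is the standard 3-sphere with a global frame of 1-forms $\{e^1,e^2,e^3\}$ satisfying $de^i=2e^{i+1}\wedge e^{i+2}$, indices taken mod 3. A prime denotes $d/dt$. In this basis, the Taub-NUT metric (with parameter $m$) is $$\frac{r+m}{16(r-m)}dr^2+\frac{m^2(r-m)}{r+m}(e^1)^2+\frac{r^2-m^2}{4}\big((e^2)^2+(e^3)^2\big),$$ and the Eguchi-Hanson metric (with parameter $a$) is $$\Big[1-\Big(\frac ar\Big)^4\Big]^{-1}dr^2+r^2\big((e^2)^2+(e^3)^2\big)+r^2\Big[1-\Big(\frac ar\Big)^4\Big](e^1)^2 .$$ "Isometric to" one of these metrics means isometric for some value of the parameter, on the corresponding range of the coordinate $r$ (the coordinate $t$ is an arc-length parameter, determined up to shift $t\mapsto t+t_0$ and sign).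
   Formalization: In cases 1 and 2 the isometry with a real-parameter Taub-NUT or Eguchi-Hanson metric is false if A_1>A_2; it is proved for A_1<A_2, and for A_1>A_2 the model is replaced by minus the Taub-NUT expression on -m<r<m, or by the Eguchi-Hanson formula with a^4 replaced by some q<0. *)

theory Defs
  imports "HOL-Analysis.Analysis"
begin

section \<open>Smooth maps on open sets\<close>

fun Ck_on :: "nat \<Rightarrow> 'a::real_normed_vector set \<Rightarrow> ('a \<Rightarrow> 'b::real_normed_vector) \<Rightarrow> bool" where
  "Ck_on 0 U f \<longleftrightarrow> continuous_on U f"
| "Ck_on (Suc k) U f \<longleftrightarrow> (\<forall>x\<in>U. f differentiable (at x)) \<and>
     (\<forall>v. Ck_on k U (\<lambda>x. frechet_derivative f (at x) v))"

definition smooth_on :: "'a::real_normed_vector set \<Rightarrow> ('a \<Rightarrow> 'b::real_normed_vector) \<Rightarrow> bool" where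
  "smooth_on U f \<longleftrightarrow> (\<forall>k. Ck_on k U f)"


section \<open>Riemannian geometry on open subsets of Euclidean space\<close>

text \<open>A metric is given by its value on a point and two tangent vectors.\<close>

type_synonym 'n metric = "real^'n \<Rightarrow> real^'n \<Rightarrow> real^'n \<Rightarrow> real"

definition metric_matrix :: "'n::finite metric \<Rightarrow> real^'n \<Rightarrow> real^'n^'n" where
  "metric_matrix g x = (\<chi> i j. g x (axis i 1) (axis j 1))"

definition partial :: "'n::finite \<Rightarrow> (real^'n \<Rightarrow> real) \<Rightarrow> real^'n \<Rightarrow> real" where
  "partial i f x = frechet_derivative f (at x) (axis i 1)"

definition christoffel :: "'n::finite metric \<Rightarrow> 'n \<Rightarrow> 'n \<Rightarrow> 'n \<Rightarrow> real^'n \<Rightarrow> real" where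
  "christoffel g k i j x =
     (1/2) * (\<Sum>l\<in>UNIV. matrix_inv (metric_matrix g x) $ k $ l *
       (partial i (\<lambda>y. metric_matrix g y $ j $ l) x
        + partial j (\<lambda>y. metric_matrix g y $ i $ l) x
        - partial l (\<lambda>y. metric_matrix g y $ i $ j) x))"

definition ricci :: "'n::finite metric \<Rightarrow> 'n \<Rightarrow> 'n \<Rightarrow> real^'n \<Rightarrow> real" where
  "ricci g i j x =
     (\<Sum>k\<in>UNIV. partial k (christoffel g k i j) x - partial j (christoffel g k i k) x
       + (\<Sum>l\<in>UNIV. christoffel g k k l x * christoffel g l i j x
                  - christoffel g k j l x * christoffel g l i k x))"

definition ricci_flat_on :: "(real^'n::finite) set \<Rightarrow> 'n metric \<Rightarrow> bool" where
  "ricci_flat_on U g \<longleftrightarrow> (\<forall>x\<in>U. \<forall>i j. ricci g i j x = 0)"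

definition diffeomorphism ::
    "(real^'n::finite) set \<Rightarrow> (real^'n) set \<Rightarrow> (real^'n \<Rightarrow> real^'n) \<Rightarrow> bool" where
  "diffeomorphism U V \<phi> \<longleftrightarrow> \<phi> ` U = V \<and> smooth_on U \<phi> \<and>
     (\<exists>\<psi>. smooth_on V \<psi> \<and> (\<forall>x\<in>U. \<psi> (\<phi> x) = x))"

definition isometric ::
    "(real^'n::finite) set \<Rightarrow> 'n metric \<Rightarrow> (real^'n) set \<Rightarrow> 'n metric \<Rightarrow> bool" where
  "isometric U g V h \<longleftrightarrow> (\<exists>\<phi>. diffeomorphism U V \<phi> \<and>
     (\<forall>x\<in>U. \<forall>u v. h (\<phi> x) (frechet_derivative \<phi> (at x) u) (frechet_derivative \<phi> (at x) v)
                    = g x u v))"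


section \<open>The manifold \<open>I \<times> S\<^sup>3\<close> and its invariant coframe\<close>

text \<open>
  The product of an open interval \<open>I\<close> with the unit sphere of \<open>real^4\<close> is described in the single
  global chart \<open>(t, p) \<mapsto> exp t *\<^sub>R p\<close>, whose image is the open shell below. In this chart the two
  projections are \<open>ln (norm x)\<close> and \<open>x /\<^sub>R norm x\<close>.
\<close>

definition cylinder :: "real set \<Rightarrow> (real^4) set" where
  "cylinder I = {x. x \<noteq> 0 \<and> ln (norm x) \<in> I}"

definition proj_t :: "real^4 \<Rightarrow> real" where
  "proj_t x = ln (norm x)"

definition proj_S3 :: "real^4 \<Rightarrow> real^4" where
  "proj_S3 x = x /\<^sub>R norm x"

lemma proj_exp:
  assumes "norm p = 1"
  shows "proj_t (exp t *\<^sub>R p) = t" and "proj_S3 (exp t *\<^sub>R p) = p"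
  using assms by (simp_all add: proj_t_def proj_S3_def)

lemma exp_proj: "x \<noteq> 0 \<Longrightarrow> exp (proj_t x) *\<^sub>R proj_S3 x = x"
  by (simp add: proj_t_def proj_S3_def)

lemma cylinder_image: "cylinder I = (\<lambda>(t, p). exp t *\<^sub>R p) ` (I \<times> sphere 0 1)"
proof (intro equalityI subsetI)
  fix x :: "real^4" assume "x \<in> cylinder I"
  then have "x = (\<lambda>(t, p). exp t *\<^sub>R p) (proj_t x, proj_S3 x)"
    and "(proj_t x, proj_S3 x) \<in> I \<times> sphere 0 1"
    by (auto simp: cylinder_def proj_t_def proj_S3_def)
  then show "x \<in> (\<lambda>(t, p). exp t *\<^sub>R p) ` (I \<times> sphere 0 1)" by (rule image_eqI)
qed (auto simp: cylinder_def)

text \<open>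
  With \<open>real^4\<close> read as the quaternions with basis 1, i, j, k, the vector \<open>quat_mult a p\<close> is the
  product of the imaginary unit number \<open>a\<close> with \<open>p\<close>. On the unit sphere these three fields form
  an orthonormal frame, and its dual coframe consists of the components of \<open>dp p\<^sup>-\<^sup>1\<close>. The index
  type \<open>3\<close> has arithmetic modulo 3.
\<close>

definition quat_mult :: "3 \<Rightarrow> real^4 \<Rightarrow> real^4" where
  "quat_mult a p =
     (if a = 1 then vector [- p$2, p$1, - p$4, p$3]
      else if a = 2 then vector [- p$3, p$4, p$1, - p$2]
      else vector [- p$4, - p$3, p$2, p$1])"

definition coframe_S3 :: "3 \<Rightarrow> real^4 \<Rightarrow> real^4 \<Rightarrow> real" where
  "coframe_S3 a p v = quat_mult a p \<bullet> v"

definition dt :: "real^4 \<Rightarrow> real^4 \<Rightarrow> real" where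
  "dt x v = frechet_derivative proj_t (at x) v"

definition coframe :: "3 \<Rightarrow> real^4 \<Rightarrow> real^4 \<Rightarrow> real" where
  "coframe a x v = coframe_S3 a (proj_S3 x) (frechet_derivative proj_S3 (at x) v)"

lemma vector_4:
  "(vector [w, x, y, z] :: 'a::zero^4) $ 1 = w"
  "(vector [w, x, y, z] :: 'a::zero^4) $ 2 = x"
  "(vector [w, x, y, z] :: 'a::zero^4) $ 3 = y"
  "(vector [w, x, y, z] :: 'a::zero^4) $ 4 = z"
  by (simp_all add: vector_def)

lemma quat_mult_self: "quat_mult a x \<bullet> x = 0"
  by (simp add: vector_4 quat_mult_def inner_vec_def sum_4 algebra_simps)

lemma quat_mult_scaleR: "quat_mult a (c *\<^sub>R x) = c *\<^sub>R quat_mult a x"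
  by (simp add: vector_4 quat_mult_def vec_eq_iff forall_4)

lemma dt_eq:
  assumes "x \<noteq> 0"
  shows "dt x v = (x \<bullet> v) / (norm x)\<^sup>2"
proof -
  have "((\<lambda>x. ln (norm x)) has_derivative (\<lambda>v. (x \<bullet> v) / (norm x)\<^sup>2)) (at x)"
    using assms by (auto intro!: derivative_eq_intros has_derivative_norm
      simp: sgn_div_norm inner_commute power2_eq_square divide_simps)
  then show ?thesis
    by (simp add: dt_def proj_t_def[abs_def] frechet_derivative_at[symmetric])
qed

lemma coframe_eq:
  assumes "x \<noteq> 0"
  shows "coframe a x v = (quat_mult a x \<bullet> v) / (norm x)\<^sup>2"
proof -
  have "((\<lambda>x. x /\<^sub>R norm x) has_derivative
      (\<lambda>v. v /\<^sub>R norm x - (inverse (norm x) * (sgn x \<bullet> v) * inverse (norm x)) *\<^sub>R x)) (at x)"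
    using assms by (auto intro!: derivative_eq_intros has_derivative_norm simp: inner_commute)
  then have "frechet_derivative proj_S3 (at x) v =
      v /\<^sub>R norm x - (inverse (norm x) * (sgn x \<bullet> v) * inverse (norm x)) *\<^sub>R x"
    by (simp add: proj_S3_def[abs_def] frechet_derivative_at[symmetric])
  then show ?thesis
    using assms by (simp add: coframe_def coframe_S3_def proj_S3_def quat_mult_scaleR
      inner_diff_right quat_mult_self power2_eq_square divide_simps)
qed

definition ext_deriv :: "(real^4 \<Rightarrow> real^4 \<Rightarrow> real) \<Rightarrow> real^4 \<Rightarrow> real^4 \<Rightarrow> real^4 \<Rightarrow> real" where
  "ext_deriv \<omega> x u v =
     frechet_derivative (\<lambda>y. \<omega> y v) (at x) u - frechet_derivative (\<lambda>y. \<omega> y u) (at x) v"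

definition wedge ::
    "(real^4 \<Rightarrow> real^4 \<Rightarrow> real) \<Rightarrow> (real^4 \<Rightarrow> real^4 \<Rightarrow> real) \<Rightarrow> real^4 \<Rightarrow> real^4 \<Rightarrow> real^4 \<Rightarrow> real" where
  "wedge \<alpha> \<beta> x u v = \<alpha> x u * \<beta> x v - \<alpha> x v * \<beta> x u"

lemma has_derivative_quat_mult: "(quat_mult a has_derivative quat_mult a) (at x)"
proof -
  have "linear (quat_mult a)"
    by (rule linearI) (simp_all add: vector_4 quat_mult_def vec_eq_iff forall_4)
  then show ?thesis
    by (simp add: linear_imp_has_derivative)
qed

lemma frechet_derivative_coframe:
  assumes "x \<noteq> 0"
  shows "frechet_derivative (\<lambda>y. coframe a y v) (at x) u =
    (quat_mult a u \<bullet> v) / (norm x)\<^sup>2 - 2 * (quat_mult a x \<bullet> v) * (x \<bullet> u) / ((norm x)\<^sup>2)\<^sup>2"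
proof -
  have "((\<lambda>y. (quat_mult a y \<bullet> v) / (y \<bullet> y)) has_derivative
      (\<lambda>u. (quat_mult a u \<bullet> v) / (x \<bullet> x) - 2 * (quat_mult a x \<bullet> v) * (x \<bullet> u) / (x \<bullet> x)\<^sup>2)) (at x)"
    using assms
    by (auto intro!: derivative_eq_intros has_derivative_quat_mult
      simp: inner_commute power2_eq_square divide_simps algebra_simps)
  then have "((\<lambda>y. coframe a y v) has_derivative
      (\<lambda>u. (quat_mult a u \<bullet> v) / (x \<bullet> x) - 2 * (quat_mult a x \<bullet> v) * (x \<bullet> u) / (x \<bullet> x)\<^sup>2)) (at x)"
    by (rule has_derivative_transform_within_open[of _ _ _ _ "- {0}"])
       (use assms in \<open>auto simp: coframe_eq power2_norm_eq_inner\<close>)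
  then show ?thesis
    by (simp add: frechet_derivative_at[symmetric] power2_norm_eq_inner)
qed

lemma ext_deriv_coframe:
  assumes "x \<noteq> 0"
  shows "ext_deriv (coframe a) x u v = 2 * wedge (coframe (a + 1)) (coframe (a + 2)) x u v"
proof -
  define N where "N = (norm x)\<^sup>2"
  have N0: "N \<noteq> 0" using assms by (simp add: N_def)
  have N: "N = x$1*x$1 + x$2*x$2 + x$3*x$3 + x$4*x$4"
    by (simp add: N_def power2_norm_eq_inner inner_vec_def sum_4)
  have key: "N * (quat_mult a u \<bullet> v - quat_mult a v \<bullet> u)
        - 2 * (quat_mult a x \<bullet> v) * (x \<bullet> u) + 2 * (quat_mult a x \<bullet> u) * (x \<bullet> v)
      = 2 * ((quat_mult (a+1) x \<bullet> u) * (quat_mult (a+2) x \<bullet> v)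
           - (quat_mult (a+1) x \<bullet> v) * (quat_mult (a+2) x \<bullet> u))"
    using exhaust_3[of a]
    by (elim disjE) (simp_all add: N vector_4 quat_mult_def inner_vec_def sum_4 algebra_simps)
  have "ext_deriv (coframe a) x u v =
      (N * (quat_mult a u \<bullet> v - quat_mult a v \<bullet> u)
        - 2 * (quat_mult a x \<bullet> v) * (x \<bullet> u) + 2 * (quat_mult a x \<bullet> u) * (x \<bullet> v)) / N\<^sup>2"
    unfolding ext_deriv_def frechet_derivative_coframe[OF assms] N_def[symmetric]
    using N0 by (simp add: power2_eq_square divide_simps) (simp add: algebra_simps)
  also have "\<dots> = 2 * wedge (coframe (a + 1)) (coframe (a + 2)) x u v"
    unfolding key wedge_def coframe_eq[OF assms] N_def[symmetric]
    using N0 by (simp add: power2_eq_square divide_simps)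
  finally show ?thesis .
qed


section \<open>Biaxial metrics\<close>

text \<open>
  The metric \<open>f\<^sub>0(t) dt\<^sup>2 + f\<^sub>1(t) (e\<^sup>1)\<^sup>2 + f\<^sub>2(t) ((e\<^sup>2)\<^sup>2 + (e\<^sup>3)\<^sup>2)\<close>; the interval coordinate
  is called \<open>r\<close> in the two families below.
\<close>

definition biaxial :: "(real \<Rightarrow> real) \<Rightarrow> (real \<Rightarrow> real) \<Rightarrow> (real \<Rightarrow> real) \<Rightarrow> 4 metric" where
  "biaxial f\<^sub>0 f\<^sub>1 f\<^sub>2 x u v =
     f\<^sub>0 (proj_t x) * dt x u * dt x v
     + f\<^sub>1 (proj_t x) * coframe 1 x u * coframe 1 x v
     + f\<^sub>2 (proj_t x) * (coframe 2 x u * coframe 2 x v + coframe 3 x u * coframe 3 x v)"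

definition taub_nut :: "real \<Rightarrow> 4 metric" where
  "taub_nut m = biaxial (\<lambda>r. (r + m) / (16 * (r - m)))
                        (\<lambda>r. m\<^sup>2 * (r - m) / (r + m))
                        (\<lambda>r. (r\<^sup>2 - m\<^sup>2) / 4)"

text \<open>
  For \<open>m > 0\<close> the Taub-NUT expression is positive definite on \<open>r > m\<close> and negative definite on
  \<open>- m < r < m\<close>. On the latter range its negative is a Riemannian metric with the coefficient of
  \<open>(e\<^sup>1)\<^sup>2\<close> larger than that of \<open>(e\<^sup>2)\<^sup>2\<close>, hence not one of those with \<open>r > m\<close>.
\<close>

text \<open>
  The Eguchi-Hanson metric depends on its parameter \<open>a\<close> only through \<open>q = a ^ 4\<close>; negative \<open>q\<close>
  corresponds to \<open>a\<close> being a real multiple of a primitive eighth root of unity.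
\<close>

definition eguchi_hanson_pow4 :: "real \<Rightarrow> 4 metric" where
  "eguchi_hanson_pow4 q = biaxial (\<lambda>r. inverse (1 - q / r ^ 4))
                                  (\<lambda>r. r\<^sup>2 * (1 - q / r ^ 4))
                                  (\<lambda>r. r\<^sup>2)"

definition eguchi_hanson :: "real \<Rightarrow> 4 metric" where
  "eguchi_hanson a = eguchi_hanson_pow4 (a ^ 4)"

lemma eguchi_hanson_eq:
  "eguchi_hanson a = biaxial (\<lambda>r. inverse (1 - (a / r) ^ 4))
                             (\<lambda>r. r\<^sup>2 * (1 - (a / r) ^ 4))
                             (\<lambda>r. r\<^sup>2)"
  by (simp add: eguchi_hanson_def eguchi_hanson_pow4_def power_divide)

text \<open>The interval coordinate of the model runs over some open subinterval of the range \<open>R\<close>.\<close>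

definition isometric_in_range :: "real set \<Rightarrow> 4 metric \<Rightarrow> real set \<Rightarrow> 4 metric \<Rightarrow> bool" where
  "isometric_in_range I g R h \<longleftrightarrow>
     (\<exists>J. open J \<and> is_interval J \<and> J \<subseteq> R \<and> isometric (cylinder I) g (cylinder J) h)"

end

theory Submission
  imports Defs
begin

text \<open>
  With \<open>y = A\<^sub>1 / A\<^sub>2\<close>, the first-order system turns the Ricci-flat equations, which are second-order
  equations for \<open>A\<^sub>1\<close> and \<open>A\<^sub>2\<close>, into polynomial equations for \<open>y\<close> alone. A constant \<open>y\<close> forces
  \<open>y = 1\<close>, so \<open>y\<close> takes infinitely many values, the polynomials vanish identically, and comparing
  coefficients leaves \<open>k\<^sub>1\<^sup>2 = 1\<close>, \<open>k\<^sub>2 = l\<^sub>1 = 0\<close>, \<open>l\<^sub>2 = - k\<^sub>1\<close>, \<open>k\<^sub>3 l\<^sub>3 = 0\<close>,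
  \<open>l\<^sub>3\<^sup>2 - 2 k\<^sub>1 k\<^sub>3 = 4\<close>. The remaining systems have the first integrals \<open>(1 - y) / A\<^sub>1\<^sup>2\<close> and
  \<open>A\<^sub>2\<^sup>4 - A\<^sub>1\<^sup>2 A\<^sub>2\<^sup>2\<close>; their values are \<open>\<plusminus> 1 / m\<^sup>2\<close> for Taub-NUT and \<open>q\<close> for
  Eguchi-Hanson, and the model coordinates are \<open>r = 2 m / y - m\<close> and \<open>r = A\<^sub>2\<close>.
\<close>

section \<open>Christoffel symbols in the radial chart\<close>

abbreviation delta :: "4 \<Rightarrow> 4 \<Rightarrow> real" where "delta i j \<equiv> axis i 1 $ j"
abbreviation Jm :: "4 \<Rightarrow> 4 \<Rightarrow> real" where "Jm i j \<equiv> quat_mult 1 (axis j 1) $ i"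

text \<open>
  Let \<open>q = quat_mult 1 x\<close>, so that \<open>\<partial>\<^sub>j q\<^sub>i = Jm i j\<close>. As \<open>x\<close> and its three quaternionic multiples are
  orthogonal of equal norm, every biaxial metric has the following form, and so has its inverse.
\<close>

definition sym_tensor :: "real \<Rightarrow> real \<Rightarrow> real \<Rightarrow> real^4 \<Rightarrow> real^4^4" where
  "sym_tensor \<alpha> \<beta> \<gamma> x = (\<chi> i j. \<alpha> * delta i j + \<beta> * x$i * x$j + \<gamma> * quat_mult 1 x $ i * quat_mult 1 x $ j)"

lemma quat_mult_1_nth:
  "quat_mult 1 x $ 1 = - x$2" "quat_mult 1 x $ 2 = x$1" "quat_mult 1 x $ 3 = - x$4" "quat_mult 1 x $ 4 = x$3"
  by (simp_all add: quat_mult_def vector_4)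

lemma norm2_4: "(norm x)\<^sup>2 = x$1*x$1 + x$2*x$2 + x$3*x$3 + x$4*x$4" for x :: "real^4"
  by (simp add: power2_norm_eq_inner inner_vec_def sum_4)

lemma delta_4: "delta i j = (if i = j then 1 else 0)"
  by (simp add: axis_def)

text \<open>The orthogonal frame diagonalises the metric: on \<open>x\<close>, on
  \<open>quat_mult 1 x\<close> and on their complement its eigenvalues are the values of
  \<open>f\<^sub>0\<close>, \<open>f\<^sub>1\<close> and \<open>f\<^sub>2\<close> divided by
  \<open>(norm x)^2\<close>. The last two coefficients measure how the first two eigenvalues differ
  from the third.\<close>

lemma metric_matrix_biaxial:
  assumes "x \<noteq> 0"
  shows "metric_matrix (biaxial f\<^sub>0 f\<^sub>1 f\<^sub>2) x =
    sym_tensor (f\<^sub>2 (proj_t x) / (norm x)^2) ((f\<^sub>0 (proj_t x) - f\<^sub>2 (proj_t x)) / (norm x)^4)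
          ((f\<^sub>1 (proj_t x) - f\<^sub>2 (proj_t x)) / (norm x)^4) x"
proof -
  define N where "N = (norm x)\<^sup>2"
  have N0: "N \<noteq> 0" using assms by (simp add: N_def)
  have N4: "(norm x)^4 = N * N" by (simp add: N_def flip: power_add)
  \<comment> \<open>Completeness of the orthogonal basis formed by \<open>x\<close> and its three
    quaternionic multiples, all of squared norm \<open>N\<close>; it eliminates the second and third
    multiples.\<close>
  have key: "quat_mult 2 x $ i * quat_mult 2 x $ j + quat_mult 3 x $ i * quat_mult 3 x $ j
     = N * delta i j - x$i * x$j - quat_mult 1 x $ i * quat_mult 1 x $ j" for i j
    using exhaust_4[of i] exhaust_4[of j]
    by (elim disjE) (simp_all add: delta_4 quat_mult_def vector_4 N_def norm2_4)
  show ?thesis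
  proof (subst vec_eq_iff, intro allI, subst vec_eq_iff, intro allI)
    fix i j
    have "metric_matrix (biaxial f\<^sub>0 f\<^sub>1 f\<^sub>2) x $ i $ j =
       (f\<^sub>0 (proj_t x) * (x$i * x$j) + f\<^sub>1 (proj_t x) * (quat_mult 1 x $ i * quat_mult 1 x $ j)
        + f\<^sub>2 (proj_t x) * (quat_mult 2 x $ i * quat_mult 2 x $ j + quat_mult 3 x $ i * quat_mult 3 x $ j)) / (N*N)"
      using N0 by (simp add: metric_matrix_def biaxial_def dt_eq coframe_eq assms inner_axis N_def[symmetric] field_simps)
    also have "\<dots> = sym_tensor (f\<^sub>2 (proj_t x) / (norm x)^2) ((f\<^sub>0 (proj_t x) - f\<^sub>2 (proj_t x)) / (norm x)^4)
          ((f\<^sub>1 (proj_t x) - f\<^sub>2 (proj_t x)) / (norm x)^4) x $ i $ j"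
      unfolding key N4 N_def[symmetric] sym_tensor_def using N0 by (simp add: field_simps)
    finally show "metric_matrix (biaxial f\<^sub>0 f\<^sub>1 f\<^sub>2) x $ i $ j = \<dots>" .
  qed
qed

lemma sym_tensor_mult_vec:
  "sym_tensor \<alpha> \<beta> \<gamma> x *v w = \<alpha> *\<^sub>R w + (\<beta> * (x \<bullet> w)) *\<^sub>R x + (\<gamma> * (quat_mult 1 x \<bullet> w)) *\<^sub>R quat_mult 1 x"
  by (simp add: vec_eq_iff forall_4 sym_tensor_def matrix_vector_mult_def inner_vec_def sum_4 delta_4 algebra_simps)

lemma quat_mult_norm: "quat_mult 1 x \<bullet> quat_mult 1 x = x \<bullet> x"
  by (simp add: inner_vec_def sum_4 quat_mult_1_nth)

text \<open>On \<open>x\<close>, on \<open>quat_mult 1 x\<close> and on their common complement the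
  left factor acts by \<alpha> + \<beta> |x|^2, \<alpha> + \<gamma> |x|^2 and \<alpha>. The
  hypotheses make the right factor act by the reciprocals.\<close>

lemma sym_tensor_mult:
  assumes "\<alpha> * \<alpha>' = 1" "\<alpha> * \<beta>' + \<beta> * \<alpha>' + \<beta> * \<beta>' * (x \<bullet> x) = 0"
    "\<alpha> * \<gamma>' + \<gamma> * \<alpha>' + \<gamma> * \<gamma>' * (x \<bullet> x) = 0"
  shows "sym_tensor \<alpha> \<beta> \<gamma> x ** sym_tensor \<alpha>' \<beta>' \<gamma>' x = mat 1"
proof -
  have "sym_tensor \<alpha> \<beta> \<gamma> x *v (sym_tensor \<alpha>' \<beta>' \<gamma>' x *v w) = w" for w
  proof -
    let ?q = "quat_mult 1 x"
    have "sym_tensor \<alpha> \<beta> \<gamma> x *v (sym_tensor \<alpha>' \<beta>' \<gamma>' x *v w) = (\<alpha> * \<alpha>') *\<^sub>R w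
       + ((\<alpha> * \<beta>' + \<beta> * \<alpha>' + \<beta> * \<beta>' * (x \<bullet> x)) * (x \<bullet> w)) *\<^sub>R x
       + ((\<alpha> * \<gamma>' + \<gamma> * \<alpha>' + \<gamma> * \<gamma>' * (x \<bullet> x)) * (?q \<bullet> w)) *\<^sub>R ?q"
      by (simp add: sym_tensor_mult_vec inner_add_right quat_mult_self inner_commute[of x ?q] quat_mult_norm
         scaleR_add_left scaleR_add_right distrib_left algebra_simps)
    then show ?thesis by (simp add: assms)
  qed
  then show ?thesis by (simp add: matrix_eq matrix_vector_mul_assoc)
qed

lemma matrix_inv_eqI:
  fixes A :: "real^'n^'n"
  assumes "A ** B = mat 1" "B ** A = mat 1"
  shows "matrix_inv A = B"
proof -
  have "A ** matrix_inv A = mat 1 \<and> matrix_inv A ** A = mat 1"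
    unfolding matrix_inv_def by (rule someI) (use assms in blast)
  then show ?thesis
    by (metis assms(2) matrix_mul_assoc matrix_mul_lid matrix_mul_rid)
qed

lemma matrix_inv_sym_tensor:
  assumes "\<alpha> * \<alpha>' = 1" "\<alpha> * \<beta>' + \<beta> * \<alpha>' + \<beta> * \<beta>' * (x \<bullet> x) = 0"
    "\<alpha> * \<gamma>' + \<gamma> * \<alpha>' + \<gamma> * \<gamma>' * (x \<bullet> x) = 0"
  shows "matrix_inv (sym_tensor \<alpha> \<beta> \<gamma> x) = sym_tensor \<alpha>' \<beta>' \<gamma>' x"
  by (rule matrix_inv_eqI; rule sym_tensor_mult; use assms in \<open>simp add: algebra_simps\<close>)

section \<open>Partial derivatives of tensors with radial coefficients\<close>

lemma partialI: "(f has_derivative D) (at x) \<Longrightarrow> partial i f x = D (axis i 1)"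
  by (simp add: partial_def frechet_derivative_at[symmetric])

lemma has_derivative_proj_t:
  assumes "x \<noteq> 0"
  shows "(proj_t has_derivative (\<lambda>v. (x \<bullet> v) / (norm x)\<^sup>2)) (at x)"
  unfolding proj_t_def[abs_def] using assms
  by (auto intro!: derivative_eq_intros has_derivative_norm
      simp: sgn_div_norm inner_commute power2_eq_square divide_simps)

lemma has_derivative_comp_proj_t:
  assumes "x \<noteq> 0" "(f has_real_derivative f') (at (proj_t x))"
  shows "((\<lambda>x. f (proj_t x)) has_derivative (\<lambda>v. f' * ((x \<bullet> v) / (norm x)\<^sup>2))) (at x)"
  using has_derivative_compose[OF has_derivative_proj_t[OF assms(1)] assms(2)[unfolded has_field_derivative_def]]
  by simp

lemma has_derivative_quat_nth: "((\<lambda>x. quat_mult a x $ i) has_derivative (\<lambda>v. quat_mult a v $ i)) (at x)"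
  by (rule bounded_linear.has_derivative[OF bounded_linear_vec_nth has_derivative_quat_mult])

lemma has_derivative_nth: "((\<lambda>x. x $ i) has_derivative (\<lambda>v. v $ i)) (at x)"
  by (rule bounded_linear.has_derivative[OF bounded_linear_vec_nth has_derivative_ident])

lemma partial_sym_tensor:
  assumes "x \<noteq> 0" "(\<alpha> has_real_derivative \<alpha>') (at (proj_t x))"
    "(\<beta> has_real_derivative \<beta>') (at (proj_t x))" "(\<gamma> has_real_derivative \<gamma>') (at (proj_t x))"
  shows "partial l (\<lambda>y. sym_tensor (\<alpha> (proj_t y)) (\<beta> (proj_t y)) (\<gamma> (proj_t y)) y $ i $ j) x =
     (\<alpha>' * delta i j + \<beta>' * x$i * x$j + \<gamma>' * quat_mult 1 x $ i * quat_mult 1 x $ j) * x$l / (norm x)\<^sup>2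
     + \<beta> (proj_t x) * (delta i l * x$j + x$i * delta j l)
     + \<gamma> (proj_t x) * (Jm i l * quat_mult 1 x $ j + quat_mult 1 x $ i * Jm j l)"
proof -
  note d = has_derivative_comp_proj_t[OF assms(1,2)] has_derivative_comp_proj_t[OF assms(1,3)]
    has_derivative_comp_proj_t[OF assms(1,4)]
  have sym: "axis l (1::real) $ i = delta i l" for i l :: 4 by (simp add: axis_def)
  show ?thesis
    unfolding sym_tensor_def vec_lambda_beta
    by (subst partialI, (rule derivative_eq_intros d has_derivative_quat_nth has_derivative_nth refl)+)
      (use assms(1) in \<open>simp add: inner_axis sym[of l] add_divide_distrib algebra_simps\<close>)
qed

text \<open>\<open>frechet_derivative\<close> is a choice among derivatives, so it is enough that
  both functions have the same ones at \<open>x\<close>. This allows formulas that hold only on an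
  open set to be differentiated there.\<close>

lemma frechet_derivative_cong_open:
  assumes "open U" "x \<in> U" "\<And>y. y \<in> U \<Longrightarrow> f y = g y"
  shows "frechet_derivative f (at x) = frechet_derivative g (at x)"
proof -
  have "(f has_derivative D) (at x) \<longleftrightarrow> (g has_derivative D) (at x)" for D
    using assms has_derivative_transform_within_open by metis
  then show ?thesis by (simp add: frechet_derivative_def)
qed

text \<open>Ansatz for the Christoffel symbols of a \<open>sym_tensor\<close> metric: the terms are
  symmetric in \<open>i\<close>, \<open>j\<close> and built only from \<open>delta\<close>,
  \<open>Jm\<close>, \<open>x\<close> and \<open>quat_mult 1 x\<close>. Only the six coefficients
  depend on the metric; they will be functions of \<open>proj_t\<close>.\<close>

definition christoffel_tensor :: "real \<Rightarrow> real \<Rightarrow> real \<Rightarrow> real \<Rightarrow> real \<Rightarrow> real \<Rightarrow> real^4 \<Rightarrow> 4 \<Rightarrow> 4 \<Rightarrow> 4 \<Rightarrow> real" where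
  "christoffel_tensor p\<^sub>1 p\<^sub>2 p\<^sub>3 p\<^sub>4 p\<^sub>5 p\<^sub>6 x k i j =
     p\<^sub>1 * (x$i * delta j k + x$j * delta i k) + p\<^sub>2 * delta i j * x$k + p\<^sub>3 * x$i * x$j * x$k
     + p\<^sub>4 * quat_mult 1 x $ i * quat_mult 1 x $ j * x$k
     + p\<^sub>5 * (x$i * quat_mult 1 x $ j + x$j * quat_mult 1 x $ i) * quat_mult 1 x $ k
     + p\<^sub>6 * (quat_mult 1 x $ j * Jm k i + quat_mult 1 x $ i * Jm k j)"

lemma sym_tensor_contract:
  "(\<Sum>l\<in>UNIV. sym_tensor n u v x $ k $ l * w l) =
     n * w k + u * x$k * (\<Sum>l\<in>UNIV. x$l * w l) + v * quat_mult 1 x $ k * (\<Sum>l\<in>UNIV. quat_mult 1 x $ l * w l)"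
  using exhaust_4[of k]
  by (elim disjE) (simp_all add: sym_tensor_def sum_4 delta_4 algebra_simps)

lemma Jm_4: "Jm 1 2 = -1" "Jm 2 1 = 1" "Jm 3 4 = -1" "Jm 4 3 = 1"
  "Jm 1 1 = 0" "Jm 2 2 = 0" "Jm 3 3 = 0" "Jm 4 4 = 0"
  "Jm 1 3 = 0" "Jm 1 4 = 0" "Jm 2 3 = 0" "Jm 2 4 = 0" "Jm 3 1 = 0" "Jm 3 2 = 0" "Jm 4 1 = 0" "Jm 4 2 = 0"
  by (simp_all add: quat_mult_1_nth delta_4)

lemma Jm_antisym: "Jm j i = - Jm i j"
  using exhaust_4[of i] exhaust_4[of j] by (elim disjE) (simp_all add: Jm_4)

text \<open>\<open>A\<close>, \<open>B\<close>, \<open>C\<close> are radial derivatives over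
  \<open>(norm x)^2\<close>, since \<open>proj_t\<close> has gradient \<open>x / (norm x)^2\<close>.
  Raising an index with the inverse metric involves only the lowered symbol and its contractions
  with \<open>x\<close> and \<open>quat_mult 1 x\<close>.\<close>

lemma christoffel_of_sym_tensor:
  assumes "open U" "x \<in> U" "x \<noteq> 0"
    and g: "\<And>y. y \<in> U \<Longrightarrow> metric_matrix g y = sym_tensor (\<alpha> (proj_t y)) (\<beta> (proj_t y)) (\<gamma> (proj_t y)) y"
    and d: "(\<alpha> has_real_derivative \<alpha>') (at (proj_t x))"
    "(\<beta> has_real_derivative \<beta>') (at (proj_t x))" "(\<gamma> has_real_derivative \<gamma>') (at (proj_t x))"
    and inv: "matrix_inv (metric_matrix g x) = sym_tensor n u v x"
    and N: "N = (norm x)\<^sup>2"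
    and ABC: "\<alpha>' = A * N" "\<beta>' = B * N" "\<gamma>' = C * N"
  shows "christoffel g k i j x = christoffel_tensor (n * A / 2) ((2 * \<beta> (proj_t x) - A) * (n + u * N) / 2)
     ((B * (n + u * N) + 2 * A * u) / 2) ((- C * (n + u * N) - 4 * u * \<gamma> (proj_t x)) / 2)
     ((C * (n + v * N) + v * (A + 2 * \<gamma> (proj_t x))) / 2) (n * \<gamma> (proj_t x)) x k i j"
proof -
  have N0: "N \<noteq> 0" using assms(3) N by simp
  have cong: "partial l (\<lambda>y. metric_matrix g y $ i $ j) x =
      partial l (\<lambda>y. sym_tensor (\<alpha> (proj_t y)) (\<beta> (proj_t y)) (\<gamma> (proj_t y)) y $ i $ j) x" for l i j
  proof -
    have "frechet_derivative (\<lambda>y. metric_matrix g y $ i $ j) (at x) =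
      frechet_derivative (\<lambda>y. sym_tensor (\<alpha> (proj_t y)) (\<beta> (proj_t y)) (\<gamma> (proj_t y)) y $ i $ j) (at x)"
      by (rule frechet_derivative_cong_open[OF assms(1,2)]) (simp add: g)
    then show ?thesis by (simp add: partial_def)
  qed
  define b c where "b = \<beta> (proj_t x)" and "c = \<gamma> (proj_t x)"
  let ?q = "\<lambda>i. quat_mult 1 x $ i"
  have p: "partial l (\<lambda>y. metric_matrix g y $ i $ j) x =
    (A * delta i j + B * x$i * x$j + C * ?q i * ?q j) * x$l
     + b * (delta i l * x$j + x$i * delta j l) + c * (Jm i l * ?q j + ?q i * Jm j l)" for i j l
    unfolding cong partial_sym_tensor[OF assms(3) d] ABC N[symmetric] b_def c_def using N0 by (simp add: field_simps)
  \<comment> \<open>Twice the Christoffel symbol with all indices lowered. As \<open>Jm\<close> is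
    antisymmetric, the terms in \<open>Jm i j\<close> and \<open>Jm j i\<close> cancel while those
    in \<open>Jm l i\<close> and \<open>Jm l j\<close> double.\<close>
  define w where "w l = (A * delta j l + B * x$j * x$l + C * ?q j * ?q l) * x$i
     + (A * delta i l + B * x$i * x$l + C * ?q i * ?q l) * x$j
     - (A * delta i j + B * x$i * x$j + C * ?q i * ?q j) * x$l
     + 2 * b * delta i j * x$l + 2 * c * (?q j * Jm l i + ?q i * Jm l j)" for l
  have sw: "partial i (\<lambda>y. metric_matrix g y $ j $ l) x + partial j (\<lambda>y. metric_matrix g y $ i $ l) x
        - partial l (\<lambda>y. metric_matrix g y $ i $ j) x = w l" for l
    unfolding p w_def Jm_antisym[of i l] Jm_antisym[of j l] Jm_antisym[of i j] delta_4
    by (simp add: algebra_simps)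
  have NN: "N = x$1*x$1 + x$2*x$2 + x$3*x$3 + x$4*x$4" by (simp add: N norm2_4)
  \<comment> \<open>Both contractions use that \<open>x\<close> and \<open>?q\<close> are orthogonal
    of equal norm, and that summing \<open>Jm l i\<close> over \<open>l\<close> against
    \<open>x\<close> gives \<open>- ?q i\<close>, against \<open>?q\<close> gives
    \<open>x $ i\<close>.\<close>
  have s1: "(\<Sum>l\<in>UNIV. x$l * w l) = (2 * A + B * N) * x$i * x$j - A * N * delta i j - (C * N + 4 * c) * ?q i * ?q j
      + 2 * b * N * delta i j"
    using exhaust_4[of i] exhaust_4[of j] unfolding w_def NN
    by (elim disjE) (simp_all add: sum_4 Jm_4 delta_4 quat_mult_1_nth algebra_simps)
  have s2: "(\<Sum>l\<in>UNIV. ?q l * w l) = (A + C * N + 2 * c) * (x$i * ?q j + x$j * ?q i)"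
    using exhaust_4[of i] exhaust_4[of j] unfolding w_def NN
    by (elim disjE) (simp_all add: sum_4 Jm_4 delta_4 quat_mult_1_nth algebra_simps)
  show ?thesis
    unfolding christoffel_def inv sw sym_tensor_contract s1 s2
    unfolding w_def christoffel_tensor_def b_def[symmetric] c_def[symmetric]
    by (simp add: field_simps)
qed

lemma partial_christoffel_tensor:
  assumes "x \<noteq> 0" "(p\<^sub>1 has_real_derivative p\<^sub>1') (at (proj_t x))"
    "(p\<^sub>2 has_real_derivative p\<^sub>2') (at (proj_t x))" "(p\<^sub>3 has_real_derivative p\<^sub>3') (at (proj_t x))"
    "(p\<^sub>4 has_real_derivative p\<^sub>4') (at (proj_t x))" "(p\<^sub>5 has_real_derivative p\<^sub>5') (at (proj_t x))"
    "(p\<^sub>6 has_real_derivative p\<^sub>6') (at (proj_t x))"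
  shows "partial m (\<lambda>y. christoffel_tensor (p\<^sub>1 (proj_t y)) (p\<^sub>2 (proj_t y)) (p\<^sub>3 (proj_t y)) (p\<^sub>4 (proj_t y)) (p\<^sub>5 (proj_t y))
       (p\<^sub>6 (proj_t y)) y k i j) x =
     christoffel_tensor p\<^sub>1' p\<^sub>2' p\<^sub>3' p\<^sub>4' p\<^sub>5' p\<^sub>6' x k i j * x$m / (norm x)\<^sup>2
     + p\<^sub>1 (proj_t x) * (delta i m * delta j k + delta j m * delta i k) + p\<^sub>2 (proj_t x) * delta i j * delta k m
     + p\<^sub>3 (proj_t x) * (delta i m * x$j * x$k + x$i * delta j m * x$k + x$i * x$j * delta k m)
     + p\<^sub>4 (proj_t x) * (Jm i m * quat_mult 1 x $ j * x$k + quat_mult 1 x $ i * Jm j m * x$k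
          + quat_mult 1 x $ i * quat_mult 1 x $ j * delta k m)
     + p\<^sub>5 (proj_t x) * ((delta i m * quat_mult 1 x $ j + x$i * Jm j m + delta j m * quat_mult 1 x $ i + x$j * Jm i m)
           * quat_mult 1 x $ k
         + (x$i * quat_mult 1 x $ j + x$j * quat_mult 1 x $ i) * Jm k m)
     + p\<^sub>6 (proj_t x) * (Jm j m * Jm k i + Jm i m * Jm k j)"
proof -
  note d = assms(2-7)[THEN has_derivative_comp_proj_t[OF assms(1)]]
  have sym: "axis l (1::real) $ i = delta i l" for i l :: 4 by (simp add: axis_def)
  show ?thesis
    unfolding christoffel_tensor_def
    by (subst partialI, (rule derivative_eq_intros d has_derivative_quat_nth has_derivative_nth refl)+)
      (use assms(1) in \<open>simp add: inner_axis sym[of m] add_divide_distrib algebra_simps\<close>)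
qed

section \<open>Ricci curvature\<close>

text \<open>
  Homogeneity makes it enough to evaluate at \<open>x = \<rho> e\<^sub>1\<close>, where \<open>q = \<rho> e\<^sub>2\<close> and the coframe is
  proportional to the coordinate differentials.
\<close>

lemma ricci_christoffel_tensor:
  assumes "open U" "x \<in> U" and x: "x = \<rho> *\<^sub>R axis 1 1" and \<rho>: "\<rho> > 0" and t: "t = ln \<rho>"
    and \<Gamma>: "\<And>y k i j. y \<in> U \<Longrightarrow> christoffel g k i j y =
       christoffel_tensor (p\<^sub>1 (proj_t y)) (p\<^sub>2 (proj_t y)) (p\<^sub>3 (proj_t y)) (p\<^sub>4 (proj_t y)) (p\<^sub>5 (proj_t y)) (p\<^sub>6 (proj_t y)) y k i j"
    and d: "(p\<^sub>1 has_real_derivative p\<^sub>1') (at t)" "(p\<^sub>2 has_real_derivative p\<^sub>2') (at t)"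
      "(p\<^sub>3 has_real_derivative p\<^sub>3') (at t)" "(p\<^sub>4 has_real_derivative p\<^sub>4') (at t)"
      "(p\<^sub>5 has_real_derivative p\<^sub>5') (at t)" "(p\<^sub>6 has_real_derivative p\<^sub>6') (at t)"
  shows "ricci g 1 1 x = 3 * p\<^sub>2 t + 3 * \<rho>^2 * p\<^sub>3 t - 5 * \<rho>^2 * p\<^sub>5 t
        - 3 * p\<^sub>6 t - 3 * p\<^sub>1' - \<rho>^2 * p\<^sub>5' - p\<^sub>6' - 3 * p\<^sub>1 t
        + 3 * \<rho>^2 * (p\<^sub>1 t)^2 + 3 * \<rho>^2 * p\<^sub>1 t * p\<^sub>2 t
        + 3 * \<rho>^4 * p\<^sub>1 t * p\<^sub>3 t + \<rho>^4 * p\<^sub>2 t * p\<^sub>5 t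
        + \<rho>^6 * p\<^sub>3 t * p\<^sub>5 t + \<rho>^2 * p\<^sub>2 t * p\<^sub>6 t
        + \<rho>^4 * p\<^sub>3 t * p\<^sub>6 t - \<rho>^6 * (p\<^sub>5 t)^2
        - 2 * \<rho>^4 * p\<^sub>5 t * p\<^sub>6 t - \<rho>^2 * (p\<^sub>6 t)^2" (is ?R1)
    "ricci g 2 2 x = p\<^sub>2' + \<rho>^2 * p\<^sub>4' - 2 * p\<^sub>6' + 3 * p\<^sub>2 t
        + 6 * \<rho>^2 * p\<^sub>4 t - 3 * p\<^sub>6 t - 3 * p\<^sub>1 t - \<rho>^2 * p\<^sub>3 t
        + \<rho>^2 * p\<^sub>5 t + 3 * \<rho>^2 * p\<^sub>1 t * p\<^sub>2 t
        + 3 * \<rho>^4 * p\<^sub>1 t * p\<^sub>4 t - 6 * \<rho>^2 * p\<^sub>1 t * p\<^sub>6 t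
        + \<rho>^2 * (p\<^sub>2 t)^2 + \<rho>^4 * p\<^sub>2 t * p\<^sub>4 t
        - 3 * \<rho>^2 * p\<^sub>2 t * p\<^sub>6 t + \<rho>^4 * p\<^sub>2 t * p\<^sub>3 t
        + \<rho>^6 * p\<^sub>3 t * p\<^sub>4 t - 2 * \<rho>^4 * p\<^sub>3 t * p\<^sub>6 t
        - \<rho>^4 * p\<^sub>2 t * p\<^sub>5 t - \<rho>^6 * p\<^sub>4 t * p\<^sub>5 t
        + 2 * \<rho>^4 * p\<^sub>5 t * p\<^sub>6 t - \<rho>^4 * p\<^sub>4 t * p\<^sub>6 t
        + 4 * \<rho>^2 * (p\<^sub>6 t)^2" (is ?R2)
    "ricci g 3 3 x = p\<^sub>2' + 3 * p\<^sub>2 t - \<rho>^2 * p\<^sub>3 t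
        + 3 * \<rho>^2 * p\<^sub>1 t * p\<^sub>2 t + \<rho>^2 * (p\<^sub>2 t)^2
        + \<rho>^4 * p\<^sub>2 t * p\<^sub>3 t - \<rho>^2 * p\<^sub>5 t
        + \<rho>^4 * p\<^sub>2 t * p\<^sub>5 t + \<rho>^2 * p\<^sub>2 t * p\<^sub>6 t - 3 * p\<^sub>1 t
        - 3 * p\<^sub>6 t" (is ?R3)
proof -
  have nx: "norm x = \<rho>" using \<rho> by (simp add: x norm_axis_1)
  have px: "proj_t x = t" by (simp add: proj_t_def nx t)
  have x0: "x \<noteq> 0" using nx \<rho> by auto
  have xi: "x $ 1 = \<rho>" "x $ 2 = 0" "x $ 3 = 0" "x $ 4 = 0" by (simp_all add: x axis_def)
  have q: "quat_mult 1 x $ 1 = 0" "quat_mult 1 x $ 2 = \<rho>" "quat_mult 1 x $ 3 = 0" "quat_mult 1 x $ 4 = 0"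
    by (simp_all add: quat_mult_1_nth xi)
  have p: "partial m (christoffel g k i j) x = partial m (\<lambda>y.
     christoffel_tensor (p\<^sub>1 (proj_t y)) (p\<^sub>2 (proj_t y)) (p\<^sub>3 (proj_t y)) (p\<^sub>4 (proj_t y)) (p\<^sub>5 (proj_t y)) (p\<^sub>6 (proj_t y)) y k i j) x" for m k i j
    unfolding partial_def by (rule arg_cong[where f = "\<lambda>D. D _"], rule frechet_derivative_cong_open[OF assms(1,2)], rule \<Gamma>)
  have d4: "delta 1 1 = 1" "delta 1 2 = 0" "delta 1 3 = 0" "delta 1 4 = 0"
    "delta 2 1 = 0" "delta 2 2 = 1" "delta 2 3 = 0" "delta 2 4 = 0"
    "delta 3 1 = 0" "delta 3 2 = 0" "delta 3 3 = 1" "delta 3 4 = 0"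
    "delta 4 1 = 0" "delta 4 2 = 0" "delta 4 3 = 0" "delta 4 4 = 1" by (simp_all add: delta_4)
  note pd = partial_christoffel_tensor[OF x0 d[folded px], unfolded px nx]
  note G = \<Gamma>[OF assms(2), unfolded px]
  have r: "\<rho>^4 = \<rho> * \<rho> * \<rho> * \<rho>" "\<rho>^6 = \<rho> * \<rho> * \<rho> * \<rho> * \<rho> * \<rho>"
    by (simp_all add: numeral_eq_Suc)
  \<comment> \<open>Here \<open>x\<close> and \<open>quat_mult 1 x\<close> have one nonzero
    component each, so most terms vanish. The indices 1, 2, 3 stand for the directions dual to
    \<open>dt\<close> and to the first two coframe elements.\<close>
  show ?R1 ?R2 ?R3
    unfolding ricci_def p pd G sum_4
    unfolding christoffel_tensor_def xi q Jm_4 d4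
    using \<rho> by (simp_all only: mult_zero_left mult_zero_right add_0_left add_0_right diff_0_right
        mult_1_left mult_1_right minus_zero mult_minus_left mult_minus_right minus_minus div_0 diff_zero)
      (simp_all add: field_simps power2_eq_square r)
qed

text \<open>In the chart \<open>norm x\<close> equals \<open>exp (proj_t x)\<close>, so the radial
  coefficients carry powers of \<open>exp s\<close> in their denominators.\<close>

lemma DERIV_div_exp_power:
  assumes "(f has_real_derivative f') (at s)"
  shows "((\<lambda>s. f s / exp s ^ n) has_real_derivative (f' - n * f s) / exp s ^ n) (at s)"
proof -
  have "((\<lambda>s. f s * exp (- n * s)) has_real_derivative (f' - n * f s) * exp (- n * s)) (at s)"
    by (rule derivative_eq_intros assms refl)+ (simp add: algebra_simps)
  moreover have "z * exp (- n * s) = z / exp s ^ n" for z s :: real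
    by (simp add: exp_minus exp_of_nat2_mult field_simps)
  ultimately show ?thesis by simp
qed

lemma open_cylinder:
  assumes "open I" shows "open (cylinder I)"
proof -
  have "cylinder I = proj_t -` I \<inter> (- {0})" by (auto simp: cylinder_def proj_t_def)
  moreover have "continuous_on (- {0}) proj_t"
    unfolding proj_t_def by (intro continuous_intros) auto
  ultimately show ?thesis
    using continuous_on_open_vimage[of "- {0}" proj_t] assms by auto
qed

lemma christoffel_tensor_cong:
  assumes "p\<^sub>1 = p\<^sub>1'" "p\<^sub>2 = p\<^sub>2'" "p\<^sub>3 = p\<^sub>3'" "p\<^sub>4 = p\<^sub>4'" "p\<^sub>5 = p\<^sub>5'" "p\<^sub>6 = p\<^sub>6'"
  shows "christoffel_tensor p\<^sub>1 p\<^sub>2 p\<^sub>3 p\<^sub>4 p\<^sub>5 p\<^sub>6 x k i j = christoffel_tensor p\<^sub>1' p\<^sub>2' p\<^sub>3' p\<^sub>4' p\<^sub>5' p\<^sub>6' x k i j"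
  using assms by simp

lemma christoffel_biaxial:
  assumes I: "open I" and x: "x \<in> cylinder I"
    and a: "\<And>s. s \<in> I \<Longrightarrow> (a has_real_derivative a\<^sub>1 s) (at s)"
    and b: "\<And>s. s \<in> I \<Longrightarrow> (b has_real_derivative b\<^sub>1 s) (at s)"
    and pos: "\<And>s. s \<in> I \<Longrightarrow> a s \<noteq> 0" "\<And>s. s \<in> I \<Longrightarrow> b s \<noteq> 0"
    and s: "s = proj_t x"
  shows "christoffel (biaxial (\<lambda>t. 1) (\<lambda>t. (a t)\<^sup>2) (\<lambda>t. (b t)\<^sup>2)) k i j x = christoffel_tensor
      ((b\<^sub>1 s / b s - 1) / exp s ^ 2)
      ((1 - b s * b\<^sub>1 s) / exp s ^ 2)
      ((b s * b\<^sub>1 s - 2 * b\<^sub>1 s / b s) / exp s ^ 4)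
      ((b s * b\<^sub>1 s - a s * a\<^sub>1 s + 2 * (a s)\<^sup>2 / (b s)\<^sup>2 - 2) / exp s ^ 4)
      ((a\<^sub>1 s / a s - b\<^sub>1 s / b s + 1 - (a s)\<^sup>2 / (b s)\<^sup>2) / exp s ^ 4)
      (((a s)\<^sup>2 / (b s)\<^sup>2 - 1) / exp s ^ 2) x k i j"
proof -
  have sI: "s \<in> I" and x0: "x \<noteq> 0" using x by (auto simp: cylinder_def s proj_t_def)
  have n: "norm y = exp (proj_t y)" if "y \<in> cylinder I" for y
    using that by (auto simp: cylinder_def proj_t_def)
  let ?g = "biaxial (\<lambda>t. 1) (\<lambda>t. (a t)\<^sup>2) (\<lambda>t. (b t)\<^sup>2)"
  let ?\<alpha> = "\<lambda>s. (b s)\<^sup>2 / exp s ^ 2" and ?\<beta> = "\<lambda>s. (1 - (b s)\<^sup>2) / exp s ^ 4"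
  let ?\<gamma> = "\<lambda>s. ((a s)\<^sup>2 - (b s)\<^sup>2) / exp s ^ 4"
  have g: "metric_matrix ?g y = sym_tensor (?\<alpha> (proj_t y)) (?\<beta> (proj_t y)) (?\<gamma> (proj_t y)) y"
    if "y \<in> cylinder I" for y
    using metric_matrix_biaxial[of y] that n[OF that] by (simp add: cylinder_def)
  have d: "(?\<alpha> has_real_derivative (2 * b s * b\<^sub>1 s - 2 * (b s)\<^sup>2) / exp s ^ 2) (at s)"
    "(?\<beta> has_real_derivative (- 2 * b s * b\<^sub>1 s - 4 * (1 - (b s)\<^sup>2)) / exp s ^ 4) (at s)"
    "(?\<gamma> has_real_derivative (2 * a s * a\<^sub>1 s - 2 * b s * b\<^sub>1 s - 4 * ((a s)\<^sup>2 - (b s)\<^sup>2)) / exp s ^ 4) (at s)"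
    by - (rule DERIV_cong[OF DERIV_div_exp_power],
        (rule derivative_eq_intros a[OF sI] b[OF sI] refl)+, simp)+
  define E where "E = exp s"
  have E0: "E \<noteq> 0" by (simp add: E_def)
  note nz = pos[OF sI] E0
  have N: "E\<^sup>2 = (norm x)\<^sup>2" using n[OF x] by (simp add: E_def s)
  have xx: "x \<bullet> x = E * E" using N by (simp add: dot_square_norm power2_eq_square)
  \<comment> \<open>The metric has eigenvalue \<open>1 / E^2\<close> on \<open>x\<close>,
    \<open>(a s)^2 / E^2\<close> on \<open>quat_mult 1 x\<close> and \<open>(b s)^2 / E^2\<close> on
    the complement. The coefficients of the inverse come from the reciprocals: that of the
    complement, then the differences to it divided by \<open>E^2\<close>.\<close>
  have inv: "matrix_inv (metric_matrix ?g x) = sym_tensor (E\<^sup>2 / (b s)\<^sup>2) (1 - 1 / (b s)\<^sup>2) (1 / (a s)\<^sup>2 - 1 / (b s)\<^sup>2) x"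
    unfolding g[OF x] s[symmetric] E_def[symmetric]
    by (rule matrix_inv_sym_tensor; use nz in \<open>simp add: xx field_simps numeral_eq_Suc\<close>)
  \<comment> \<open>The instances of \<open>A\<close>, \<open>B\<close>, \<open>C\<close> are the
    derivatives in \<open>d\<close> divided by the squared norm \<open>E^2\<close>.\<close>
  show ?thesis
    by (rule trans[OF christoffel_of_sym_tensor[OF open_cylinder[OF I] x x0 g d[unfolded s] inv N,
          where A = "(2 * b s * b\<^sub>1 s - 2 * (b s)\<^sup>2) / E ^ 4"
            and B = "(- 2 * b s * b\<^sub>1 s - 4 * (1 - (b s)\<^sup>2)) / E ^ 6"
            and C = "(2 * a s * a\<^sub>1 s - 2 * b s * b\<^sub>1 s - 4 * ((a s)\<^sup>2 - (b s)\<^sup>2)) / E ^ 6"] christoffel_tensor_cong];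
        (assumption | use nz in \<open>simp add: s[symmetric] E_def[symmetric] field_simps numeral_eq_Suc\<close>))
qed

text \<open>The expressions in parentheses are the Ricci curvatures of unit vectors along dt, e^1
  and e^2. The remaining factors \<open>1\<close>, \<open>(a t)^2\<close>, \<open>(b t)^2\<close>
  over \<open>exp t ^ 2\<close> are the squared lengths of the coordinate vectors at
  \<open>x\<close>.\<close>

lemma ricci_biaxial:
  assumes I: "open I" and t: "t \<in> I"
    and a: "\<And>s. s \<in> I \<Longrightarrow> (a has_real_derivative a\<^sub>1 s) (at s)"
    and b: "\<And>s. s \<in> I \<Longrightarrow> (b has_real_derivative b\<^sub>1 s) (at s)"
    and a1: "(a\<^sub>1 has_real_derivative a\<^sub>2) (at t)" and b1: "(b\<^sub>1 has_real_derivative b\<^sub>2) (at t)"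
    and pos: "\<And>s. s \<in> I \<Longrightarrow> a s \<noteq> 0" "\<And>s. s \<in> I \<Longrightarrow> b s \<noteq> 0"
    and g: "g = biaxial (\<lambda>t. 1) (\<lambda>t. (a t)\<^sup>2) (\<lambda>t. (b t)\<^sup>2)"
    and x: "x = exp t *\<^sub>R axis 1 1"
  shows "ricci g 1 1 x = (- a\<^sub>2 / a t - 2 * b\<^sub>2 / b t) / exp t ^ 2" (is ?R1)
    "ricci g 2 2 x = (- a\<^sub>2 / a t - 2 * a\<^sub>1 t * b\<^sub>1 t / (a t * b t) + 2 * (a t)\<^sup>2 / b t ^ 4) * (a t)\<^sup>2 / exp t ^ 2" (is ?R2)
    "ricci g 3 3 x = (- b\<^sub>2 / b t - a\<^sub>1 t * b\<^sub>1 t / (a t * b t) - (b\<^sub>1 t)\<^sup>2 / (b t)\<^sup>2 + 4 / (b t)\<^sup>2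
       - 2 * (a t)\<^sup>2 / b t ^ 4) * (b t)\<^sup>2 / exp t ^ 2" (is ?R3)
proof -
  have x0: "x \<in> cylinder I" using t by (simp add: cylinder_def x norm_axis_1)
  define E where "E = exp t"
  have E0: "E \<noteq> 0" by (simp add: E_def)
  note nz = pos[OF t] E0
  let ?y = "(a\<^sub>1 t * b t - a t * b\<^sub>1 t) / (b t)\<^sup>2"
  let ?b = "(b\<^sub>2 * b t - b\<^sub>1 t * b\<^sub>1 t) / (b t)\<^sup>2"
  let ?a = "(a\<^sub>2 * a t - a\<^sub>1 t * a\<^sub>1 t) / (a t)\<^sup>2"
  have d0: "((\<lambda>s. b\<^sub>1 s / b s) has_real_derivative ?b) (at t)"
    "((\<lambda>s. a\<^sub>1 s / a s) has_real_derivative ?a) (at t)"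
    "((\<lambda>s. (a s)\<^sup>2 / (b s)\<^sup>2) has_real_derivative 2 * (a t / b t) * ?y) (at t)"
    "((\<lambda>s. b s * b\<^sub>1 s) has_real_derivative b t * b\<^sub>2 + b\<^sub>1 t * b\<^sub>1 t) (at t)"
    "((\<lambda>s. a s * a\<^sub>1 s) has_real_derivative a t * a\<^sub>2 + a\<^sub>1 t * a\<^sub>1 t) (at t)"
    using pos[OF t]
    by (auto intro!: derivative_eq_intros a[OF t] b[OF t] a1 b1 simp: field_simps power2_eq_square)
  have d: "((\<lambda>s. (b\<^sub>1 s / b s - 1) / exp s ^ 2) has_real_derivative
        (?b - 2 * (b\<^sub>1 t / b t - 1)) / exp t ^ 2) (at t)"
    "((\<lambda>s. (1 - b s * b\<^sub>1 s) / exp s ^ 2) has_real_derivative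
        (- (b t * b\<^sub>2 + b\<^sub>1 t * b\<^sub>1 t) - 2 * (1 - b t * b\<^sub>1 t)) / exp t ^ 2) (at t)"
    "((\<lambda>s. (b s * b\<^sub>1 s - 2 * (b\<^sub>1 s / b s)) / exp s ^ 4) has_real_derivative
        (b t * b\<^sub>2 + b\<^sub>1 t * b\<^sub>1 t - 2 * ?b - 4 * (b t * b\<^sub>1 t - 2 * (b\<^sub>1 t / b t))) / exp t ^ 4) (at t)"
    "((\<lambda>s. (b s * b\<^sub>1 s - a s * a\<^sub>1 s + 2 * ((a s)\<^sup>2 / (b s)\<^sup>2) - 2) / exp s ^ 4) has_real_derivative
        (b t * b\<^sub>2 + b\<^sub>1 t * b\<^sub>1 t - (a t * a\<^sub>2 + a\<^sub>1 t * a\<^sub>1 t) + 2 * (2 * (a t / b t) * ?y)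
         - 4 * (b t * b\<^sub>1 t - a t * a\<^sub>1 t + 2 * ((a t)\<^sup>2 / (b t)\<^sup>2) - 2)) / exp t ^ 4) (at t)"
    "((\<lambda>s. (a\<^sub>1 s / a s - b\<^sub>1 s / b s + 1 - (a s)\<^sup>2 / (b s)\<^sup>2) / exp s ^ 4) has_real_derivative
        (?a - ?b - 2 * (a t / b t) * ?y
         - 4 * (a\<^sub>1 t / a t - b\<^sub>1 t / b t + 1 - (a t)\<^sup>2 / (b t)\<^sup>2)) / exp t ^ 4) (at t)"
    "((\<lambda>s. ((a s)\<^sup>2 / (b s)\<^sup>2 - 1) / exp s ^ 2) has_real_derivative
        (2 * (a t / b t) * ?y - 2 * ((a t)\<^sup>2 / (b t)\<^sup>2 - 1)) / exp t ^ 2) (at t)"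
    by - (rule DERIV_cong[OF DERIV_div_exp_power], (rule derivative_eq_intros d0 refl)+, simp)+
  have c: "christoffel g k i j y =
    christoffel_tensor ((\<lambda>s. (b\<^sub>1 s / b s - 1) / exp s ^ 2) (proj_t y))
      ((\<lambda>s. (1 - b s * b\<^sub>1 s) / exp s ^ 2) (proj_t y))
      ((\<lambda>s. (b s * b\<^sub>1 s - 2 * (b\<^sub>1 s / b s)) / exp s ^ 4) (proj_t y))
      ((\<lambda>s. (b s * b\<^sub>1 s - a s * a\<^sub>1 s + 2 * ((a s)\<^sup>2 / (b s)\<^sup>2) - 2) / exp s ^ 4) (proj_t y))
      ((\<lambda>s. (a\<^sub>1 s / a s - b\<^sub>1 s / b s + 1 - (a s)\<^sup>2 / (b s)\<^sup>2) / exp s ^ 4) (proj_t y))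
      ((\<lambda>s. ((a s)\<^sup>2 / (b s)\<^sup>2 - 1) / exp s ^ 2) (proj_t y)) y k i j" if "y \<in> cylinder I" for y k i j
    unfolding g using christoffel_biaxial[OF I that a b pos refl] by simp
  have "E > 0" "t = ln E" by (simp_all add: E_def)
  note R = ricci_christoffel_tensor[OF open_cylinder[OF I] x0 x[folded E_def] this c d, folded E_def]
  \<comment> \<open>The ratio \<open>y\<close> and the quotients of the derivatives by
    \<open>a t\<close> or \<open>b t\<close> serve as independent variables, so that only powers of
    \<open>y\<close>, \<open>b'\<close> and \<open>E\<close> remain in the denominators.\<close>
  define b' y where "b' = b t" and "y = a t / b t"
  define A\<^sub>1 A\<^sub>2 B\<^sub>1 B\<^sub>2 where "A\<^sub>1 = a\<^sub>1 t / a t" and "A\<^sub>2 = a\<^sub>2 / a t" and "B\<^sub>1 = b\<^sub>1 t / b t" and "B\<^sub>2 = b\<^sub>2 / b t"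
  have eqs: "a\<^sub>1 t = A\<^sub>1 * (y * b')" "a\<^sub>2 = A\<^sub>2 * (y * b')" "b\<^sub>1 t = B\<^sub>1 * b'" "b\<^sub>2 = B\<^sub>2 * b'" "a t = y * b'" "b t = b'"
    using nz by (simp_all add: b'_def y_def A\<^sub>1_def A\<^sub>2_def B\<^sub>1_def B\<^sub>2_def)
  have nz': "y \<noteq> 0" "b' \<noteq> 0" "E \<noteq> 0" using nz by (simp_all add: b'_def y_def)
  show ?R1 unfolding E_def[symmetric]
    by (subst R(1), assumption) (unfold eqs, use nz' in \<open>simp add: field_simps numeral_eq_Suc\<close>)
  show ?R3 unfolding E_def[symmetric]
    by (subst R(3), assumption) (unfold eqs, use nz' in \<open>simp add: field_simps numeral_eq_Suc\<close>)
  show ?R2 unfolding E_def[symmetric]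
    by (subst R(2), assumption) (unfold eqs, use nz' in \<open>simp add: field_simps numeral_eq_Suc\<close>)
qed

section \<open>Polynomial equations for the coefficients\<close>

lemma poly_eq_0_on_infinite:
  fixes p :: "'a::idom poly"
  assumes "infinite S" "\<And>y. y \<in> S \<Longrightarrow> poly p y = 0"
  shows "p = 0"
  using assms poly_roots_finite[of p] finite_subset[of S "{y. poly p y = 0}"] by auto

text \<open>\<open>P\<close> and \<open>Q\<close> are the values of a' and b'. The second
  derivatives follow by the chain rule from \<open>y\<close>' = \<open>(P - y * Q) / b t\<close>, so
  clearing powers of \<open>b t\<close> and \<open>y\<close> in the three Ricci components leaves
  polynomials in \<open>y\<close>.\<close>

lemma biaxial_ricci_flat_equations:
  assumes I: "open I" and t: "t \<in> I"
    and a: "\<And>s. s \<in> I \<Longrightarrow> (a has_real_derivative k\<^sub>1 * (a s / b s)\<^sup>2 + k\<^sub>2 * (a s / b s) + k\<^sub>3) (at s)"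
    and b: "\<And>s. s \<in> I \<Longrightarrow> (b has_real_derivative l\<^sub>1 * (a s / b s)\<^sup>2 + l\<^sub>2 * (a s / b s) + l\<^sub>3) (at s)"
    and pos: "\<And>s. s \<in> I \<Longrightarrow> a s > 0" "\<And>s. s \<in> I \<Longrightarrow> b s > 0"
    and flat: "ricci_flat_on (cylinder I) (biaxial (\<lambda>t. 1) (\<lambda>t. (a t)\<^sup>2) (\<lambda>t. (b t)\<^sup>2))"
    and y: "y = a t / b t" and P: "P = k\<^sub>1 * y\<^sup>2 + k\<^sub>2 * y + k\<^sub>3" and Q: "Q = l\<^sub>1 * y\<^sup>2 + l\<^sub>2 * y + l\<^sub>3"
  shows "((\<lambda>s. a s / b s) has_real_derivative (P - y * Q) / b t) (at t)"
    "(2 * k\<^sub>1 * y + k\<^sub>2 + 2 * y * (2 * l\<^sub>1 * y + l\<^sub>2)) * (P - y * Q) = 0"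
    "(2 * k\<^sub>1 * y + k\<^sub>2) * (P - y * Q) + 2 * P * Q = 2 * y ^ 3"
    "y * (2 * l\<^sub>1 * y + l\<^sub>2) * (P - y * Q) + P * Q + y * Q\<^sup>2 = 4 * y - 2 * y ^ 3"
proof -
  have nz: "a t \<noteq> 0" "b t \<noteq> 0" using pos[OF t] by auto
  show y': "((\<lambda>s. a s / b s) has_real_derivative (P - y * Q) / b t) (at t)"
    unfolding P Q y using nz
    by (auto intro!: derivative_eq_intros a[OF t] b[OF t] simp: field_simps power2_eq_square)
  have a1: "((\<lambda>s. k\<^sub>1 * (a s / b s)\<^sup>2 + k\<^sub>2 * (a s / b s) + k\<^sub>3) has_real_derivative
      (2 * k\<^sub>1 * y + k\<^sub>2) * ((P - y * Q) / b t)) (at t)"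
    by (rule y' derivative_eq_intros refl)+ (use nz in \<open>simp add: y field_simps\<close>)
  have b1: "((\<lambda>s. l\<^sub>1 * (a s / b s)\<^sup>2 + l\<^sub>2 * (a s / b s) + l\<^sub>3) has_real_derivative
      (2 * l\<^sub>1 * y + l\<^sub>2) * ((P - y * Q) / b t)) (at t)"
    by (rule y' derivative_eq_intros refl)+ (use nz in \<open>simp add: y field_simps\<close>)
  have pos': "\<And>s. s \<in> I \<Longrightarrow> a s \<noteq> 0" "\<And>s. s \<in> I \<Longrightarrow> b s \<noteq> 0" using pos by force+
  have "exp t *\<^sub>R axis 1 1 \<in> cylinder I" using t by (simp add: cylinder_def norm_axis_1)
  then have R: "ricci (biaxial (\<lambda>t. 1) (\<lambda>t. (a t)\<^sup>2) (\<lambda>t. (b t)\<^sup>2)) i j (exp t *\<^sub>R axis 1 1) = 0" for i j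
    using flat by (simp add: ricci_flat_on_def)
  note E = ricci_biaxial[OF I t a b a1 b1 pos' refl refl, folded y, unfolded R, folded P Q]
  have at: "a t = y * b t" and y0: "y \<noteq> 0" using nz by (simp_all add: y)
  show "(2 * k\<^sub>1 * y + k\<^sub>2 + 2 * y * (2 * l\<^sub>1 * y + l\<^sub>2)) * (P - y * Q) = 0"
    using E(1) nz y0 unfolding at by (simp add: divide_simps) algebra
  show "(2 * k\<^sub>1 * y + k\<^sub>2) * (P - y * Q) + 2 * P * Q = 2 * y ^ 3"
    using E(2) nz y0 unfolding at by (simp add: divide_simps) algebra
  show "y * (2 * l\<^sub>1 * y + l\<^sub>2) * (P - y * Q) + P * Q + y * Q\<^sup>2 = 4 * y - 2 * y ^ 3"
    using E(3) nz y0 unfolding at by (simp add: divide_simps) algebra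
qed

text \<open>The first polynomial equation is a product whose factor \<open>P - y * Q\<close> is not
  identically zero; the vanishing of the other factor gives the linear relations. These collapse the
  remaining two equations to cubics whose coefficients are the quadratic relations.\<close>

lemma biaxial_ricci_flat_coefficients:
  assumes I: "open I" "is_interval I"
    and a: "\<And>s. s \<in> I \<Longrightarrow> (a has_real_derivative k\<^sub>1 * (a s / b s)\<^sup>2 + k\<^sub>2 * (a s / b s) + k\<^sub>3) (at s)"
    and b: "\<And>s. s \<in> I \<Longrightarrow> (b has_real_derivative l\<^sub>1 * (a s / b s)\<^sup>2 + l\<^sub>2 * (a s / b s) + l\<^sub>3) (at s)"
    and pos: "\<And>s. s \<in> I \<Longrightarrow> a s > 0" "\<And>s. s \<in> I \<Longrightarrow> b s > 0"
    and flat: "ricci_flat_on (cylinder I) (biaxial (\<lambda>t. 1) (\<lambda>t. (a t)\<^sup>2) (\<lambda>t. (b t)\<^sup>2))"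
    and ne: "t\<^sub>0 \<in> I" "a t\<^sub>0 \<noteq> b t\<^sub>0"
  shows "k\<^sub>1\<^sup>2 = 1" "k\<^sub>2 = 0" "l\<^sub>1 = 0" "l\<^sub>2 = - k\<^sub>1" "k\<^sub>3 * l\<^sub>3 = 0" "l\<^sub>3\<^sup>2 - 2 * k\<^sub>1 * k\<^sub>3 = 4"
proof -
  let ?y = "\<lambda>s. a s / b s"
  let ?P = "\<lambda>y. k\<^sub>1 * y\<^sup>2 + k\<^sub>2 * y + k\<^sub>3" and ?Q = "\<lambda>y. l\<^sub>1 * y\<^sup>2 + l\<^sub>2 * y + l\<^sub>3"
  note E = biaxial_ricci_flat_equations[OF I(1) _ a b pos flat refl refl refl]
  define y\<^sub>0 where "y\<^sub>0 = ?y t\<^sub>0"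
  have y0: "y\<^sub>0 > 0" "y\<^sub>0 \<noteq> 1" using ne pos[OF ne(1)] by (auto simp: y\<^sub>0_def)
  \<comment> \<open>At a stationary value P = yQ, and the last two equations become Q^2 = y^2 and
    Q^2 = 2 - y^2. So y^2 = 1, against \<open>a t\<^sub>0 \<noteq> b t\<^sub>0\<close>.\<close>
  have nonstat: "?P y\<^sub>0 - y\<^sub>0 * ?Q y\<^sub>0 \<noteq> 0"
  proof
    assume 0: "?P y\<^sub>0 - y\<^sub>0 * ?Q y\<^sub>0 = 0"
    define Q where "Q = ?Q y\<^sub>0"
    have P: "?P y\<^sub>0 = y\<^sub>0 * Q" using 0 by (simp add: Q_def)
    have e: "2 * (y\<^sub>0 * Q) * Q = 2 * y\<^sub>0 ^ 3" "y\<^sub>0 * Q * Q + y\<^sub>0 * Q\<^sup>2 = 4 * y\<^sub>0 - 2 * y\<^sub>0 ^ 3"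
      using E(3,4)[OF ne(1)] unfolding y\<^sub>0_def[symmetric] Q_def[symmetric] P by simp_all
    then have "y\<^sub>0 * ((y\<^sub>0 - 1) * (y\<^sub>0 + 1)) = 0" by algebra
    then show False using y0 by simp
  qed
  \<comment> \<open>A finite connected image is a single point; then \<open>?y\<close> would be
    constant and its derivative at \<open>t\<^sub>0\<close> zero, contrary to
    \<open>nonstat\<close>.\<close>
  have inf: "infinite (?y ` I)"
  proof
    assume fin: "finite (?y ` I)"
    have "continuous_on I ?y"
      by (intro continuous_at_imp_continuous_on ballI DERIV_isCont[OF E(1)])
    then have "connected (?y ` I)"
      using I(2) by (simp add: connected_continuous_image is_interval_connected)
    then obtain c where c: "?y ` I = {c}"
      using fin ne(1) connected_finite_iff_sing by blast
    have "(?y has_real_derivative 0) (at t\<^sub>0)"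
      by (rule has_field_derivative_transform_within_open[OF DERIV_const[of c] I(1) ne(1)]) (use c in auto)
    then have "(?P y\<^sub>0 - y\<^sub>0 * ?Q y\<^sub>0) / b t\<^sub>0 = 0"
      using E(1)[OF ne(1)] DERIV_unique unfolding y\<^sub>0_def by blast
    then show False using nonstat pos[OF ne(1)] by simp
  qed
  \<comment> \<open>\<open>?p\<close> is P - yQ as a polynomial and \<open>?d\<close> is the
    cofactor in the first Ricci equation. Polynomials over the reals have no zero divisors, so one
    of the two vanishes.\<close>
  let ?d = "[:k\<^sub>2, 2 * k\<^sub>1 + 2 * l\<^sub>2, 4 * l\<^sub>1:]"
  let ?p = "[:k\<^sub>3, k\<^sub>2 - l\<^sub>3, k\<^sub>1 - l\<^sub>2, - l\<^sub>1:]"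
  have "?d * ?p = 0"
  proof (rule poly_eq_0_on_infinite[OF inf])
    fix y assume "y \<in> ?y ` I"
    then obtain t where t: "t \<in> I" and y: "y = ?y t" by auto
    have "(2 * k\<^sub>1 * y + k\<^sub>2 + 2 * y * (2 * l\<^sub>1 * y + l\<^sub>2)) * (?P y - y * ?Q y) = 0"
      using E(2)[OF t] by (simp add: y)
    then show "poly (?d * ?p) y = 0"
      by (simp add: algebra_simps power2_eq_square del: mult_eq_0_iff)
  qed
  moreover have "poly ?p y\<^sub>0 \<noteq> 0"
    using nonstat by (simp add: algebra_simps power2_eq_square)
  then have "?p \<noteq> 0" by force
  ultimately have "?d = 0" by (simp only: mult_eq_0_iff) blast
  then show k: "k\<^sub>2 = 0" "l\<^sub>1 = 0" "l\<^sub>2 = - k\<^sub>1" by simp_all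
  \<comment> \<open>With the linear relations inserted, the linear and quadratic terms of the second
    Ricci equation cancel.\<close>
  have "[:2 * k\<^sub>3 * l\<^sub>3, 0, 0, 2 * k\<^sub>1\<^sup>2 - 2:] = 0"
  proof (rule poly_eq_0_on_infinite[OF inf])
    fix y assume "y \<in> ?y ` I"
    then obtain t where t: "t \<in> I" and y: "y = ?y t" by auto
    show "poly [:2 * k\<^sub>3 * l\<^sub>3, 0, 0, 2 * k\<^sub>1\<^sup>2 - 2:] y = 0"
      using E(3)[OF t] unfolding y[symmetric] k by simp algebra
  qed
  then show 1: "k\<^sub>1\<^sup>2 = 1" "k\<^sub>3 * l\<^sub>3 = 0" by simp_all
  have "[:k\<^sub>3 * l\<^sub>3, l\<^sub>3\<^sup>2 - 2 * k\<^sub>1 * k\<^sub>3 - 4, 0, 2 - 2 * k\<^sub>1\<^sup>2:] = 0"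
  proof (rule poly_eq_0_on_infinite[OF inf])
    fix y assume "y \<in> ?y ` I"
    then obtain t where t: "t \<in> I" and y: "y = ?y t" by auto
    show "poly [:k\<^sub>3 * l\<^sub>3, l\<^sub>3\<^sup>2 - 2 * k\<^sub>1 * k\<^sub>3 - 4, 0, 2 - 2 * k\<^sub>1\<^sup>2:] y = 0"
      using E(4)[OF t] unfolding y[symmetric] k by simp algebra
  qed
  then show "l\<^sub>3\<^sup>2 - 2 * k\<^sub>1 * k\<^sub>3 = 4" by simp
qed

section \<open>Smooth maps and radial isometries\<close>

lemma Ck_on_cong:
  assumes "open U" "\<And>x. x \<in> U \<Longrightarrow> f x = g x" "Ck_on k U f"
  shows "Ck_on k U g"
  using assms(2,3)
proof (induction k arbitrary: f g)
  case 0
  then show ?case using continuous_on_cong by force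
next
  case (Suc k)
  have eq: "frechet_derivative f (at x) = frechet_derivative g (at x)" if "x \<in> U" for x
    using frechet_derivative_cong_open[OF assms(1) that] Suc.prems(1) by blast
  have "g differentiable (at x)" if "x \<in> U" for x
    using Suc.prems that assms(1) unfolding differentiable_def
    by (metis Ck_on.simps(2) differentiable_def has_derivative_transform_within_open)
  moreover have "Ck_on k U (\<lambda>x. frechet_derivative g (at x) v)" for v
    by (rule Suc.IH[of "\<lambda>x. frechet_derivative f (at x) v"]) (use eq Suc.prems in auto)
  ultimately show ?case by simp
qed

text \<open>Allows any explicit derivative \<open>D\<close> in place of
  \<open>frechet_derivative\<close>; on an open set the two agree, and the regularity passes from
  one to the other.\<close>

lemma Ck_on_SucI:
  assumes "open U" "\<And>x. x \<in> U \<Longrightarrow> (f has_derivative D x) (at x)" "\<And>v. Ck_on k U (\<lambda>x. D x v)"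
  shows "Ck_on (Suc k) U f"
proof -
  have "D x v = frechet_derivative f (at x) v" if "x \<in> U" for x v
    using frechet_derivative_at[OF assms(2)[OF that]] by simp
  then have "Ck_on k U (\<lambda>x. frechet_derivative f (at x) v)" for v
    by (rule Ck_on_cong[OF assms(1) _ assms(3)])
  then show ?thesis using assms(2) by (auto simp: differentiable_def)
qed

lemma Ck_on_Suc_has_derivative:
  "Ck_on (Suc k) U f \<Longrightarrow> x \<in> U \<Longrightarrow> (f has_derivative frechet_derivative f (at x)) (at x)"
  using frechet_derivative_works by auto

lemma Ck_on_SucD: "Ck_on (Suc k) U f \<Longrightarrow> Ck_on k U f"
proof (induction k arbitrary: f)
  case 0
  then show ?case
    by (auto intro!: continuous_at_imp_continuous_on differentiable_imp_continuous_within)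
qed auto

lemma Ck_on_const: "open U \<Longrightarrow> Ck_on k U (\<lambda>x. c)"
proof (induction k arbitrary: c)
  case (Suc k)
  show ?case by (rule Ck_on_SucI[OF Suc.prems has_derivative_const]) (rule Suc.IH[OF Suc.prems])
qed auto

lemma Ck_on_bounded_linear:
  assumes "open U" "bounded_linear f"
  shows "Ck_on k U f"
proof (cases k)
  case (Suc j)
  show ?thesis unfolding Suc
    by (rule Ck_on_SucI[OF assms(1) bounded_linear_imp_has_derivative[OF assms(2)] Ck_on_const[OF assms(1)]])
qed (use assms linear_continuous_on in auto)

lemma Ck_on_add:
  assumes "open U" "Ck_on k U f" "Ck_on k U g"
  shows "Ck_on k U (\<lambda>x. f x + g x)"
  using assms(2,3)
proof (induction k arbitrary: f g)
  case (Suc k)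
  show ?case
    by (rule Ck_on_SucI[OF assms(1) has_derivative_add[OF Suc.prems[THEN Ck_on_Suc_has_derivative]]])
       (use Suc in auto)
qed (auto intro: continuous_intros)

lemma Ck_on_scaleR:
  fixes f :: "'a::real_normed_vector \<Rightarrow> real"
  assumes "open U" "Ck_on k U f" "Ck_on k U g"
  shows "Ck_on k U (\<lambda>x. f x *\<^sub>R g x)"
  using assms(2,3)
proof (induction k arbitrary: f g)
  case (Suc k)
  show ?case
  proof (rule Ck_on_SucI[OF assms(1) has_derivative_scaleR[OF Suc.prems[THEN Ck_on_Suc_has_derivative]]])
    fix v
    show "Ck_on k U (\<lambda>x. f x *\<^sub>R frechet_derivative g (at x) v + frechet_derivative f (at x) v *\<^sub>R g x)"
      by (intro Ck_on_add assms(1) Suc.IH Suc.prems[THEN Ck_on_SucD]) (use Suc.prems in auto)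
  qed
qed (auto intro: continuous_intros)

lemma Ck_on_mult:
  fixes f g :: "'a::real_normed_vector \<Rightarrow> real"
  assumes "open U" "Ck_on k U f" "Ck_on k U g"
  shows "Ck_on k U (\<lambda>x. f x * g x)"
  using Ck_on_scaleR[OF assms] by simp

text \<open>With a real variable in between, the chain rule is a scalar product of the derivative of
  \<open>h\<close> with the derivative of \<open>f\<close> taken along \<open>h\<close>. The
  induction therefore closes with \<open>Ck_on_scaleR\<close>, keeping \<open>h\<close>
  fixed.\<close>

lemma Ck_on_compose:
  fixes f :: "real \<Rightarrow> 'b::real_normed_vector" and h :: "'a::real_normed_vector \<Rightarrow> real"
  assumes "open U" "open V" "\<And>x. x \<in> U \<Longrightarrow> h x \<in> V" "Ck_on k V f" "Ck_on k U h"
  shows "Ck_on k U (\<lambda>x. f (h x))"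
  using assms(4,5)
proof (induction k arbitrary: f)
  case 0
  then show ?case using continuous_on_compose2[of V f U h] assms(3) by auto
next
  case (Suc k)
  have "(f has_derivative (\<lambda>v. v *\<^sub>R frechet_derivative f (at y) 1)) (at y)" if "y \<in> V" for y
  proof -
    have d: "(f has_derivative frechet_derivative f (at y)) (at y)"
      using Suc.prems(1) that by (rule Ck_on_Suc_has_derivative)
    have "frechet_derivative f (at y) v = v *\<^sub>R frechet_derivative f (at y) 1" for v
      using linear_cmul[OF has_derivative_linear[OF d], of v 1] by simp
    then have "frechet_derivative f (at y) = (\<lambda>v. v *\<^sub>R frechet_derivative f (at y) 1)" by (rule ext)
    with d show ?thesis by (rule subst[rotated])
  qed
  then have "((\<lambda>x. f (h x)) has_derivative (\<lambda>v. frechet_derivative h (at x) v *\<^sub>R frechet_derivative f (at (h x)) 1)) (at x)"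
    if "x \<in> U" for x
    using has_derivative_compose[OF Ck_on_Suc_has_derivative[OF Suc.prems(2) that]] assms(3)[OF that] by blast
  then show ?case
  proof (rule Ck_on_SucI[OF assms(1)])
    fix v
    show "Ck_on k U (\<lambda>x. frechet_derivative h (at x) v *\<^sub>R frechet_derivative f (at (h x)) 1)"
      by (intro Ck_on_scaleR assms(1) Suc.IH Ck_on_SucD[OF Suc.prems(2)]) (use Suc.prems in auto)
  qed
qed

lemma Ck_on_real_SucI:
  fixes f :: "real \<Rightarrow> real"
  assumes "open U" "\<And>x. x \<in> U \<Longrightarrow> (f has_real_derivative f' x) (at x)" "Ck_on k U f'"
  shows "Ck_on (Suc k) U f"
  by (rule Ck_on_SucI[OF assms(1) assms(2)[unfolded has_field_derivative_def]], assumption)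
     (intro Ck_on_mult Ck_on_const assms(1,3))

section \<open>Smoothness of the elementary functions and of the radial coordinate\<close>

lemma Ck_on_exp: "Ck_on k UNIV (exp :: real \<Rightarrow> real)"
proof (induction k)
  case (Suc k)
  show ?case by (rule Ck_on_real_SucI[OF open_UNIV DERIV_exp Suc.IH])
qed (auto intro: continuous_intros)

lemma Ck_on_inverse: "Ck_on k (- {0}) (inverse :: real \<Rightarrow> real)"
proof (induction k)
  case (Suc k)
  show ?case
  proof (rule Ck_on_real_SucI)
    \<comment> \<open>Writing the derivative as a product of copies of \<open>inverse\<close> lets
      the induction hypothesis apply to it.\<close>
    show "(inverse has_real_derivative - 1 * (inverse x * inverse x)) (at x)" if "x \<in> - {0}" for x :: real
      using that by (auto intro!: derivative_eq_intros)
    show "Ck_on k (- {0}) (\<lambda>x::real. - 1 * (inverse x * inverse x))"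
      by (intro Ck_on_mult Ck_on_const Suc.IH) auto
  qed auto
qed (auto intro!: continuous_intros)

lemma Ck_on_ln: "Ck_on k {0<..} (ln :: real \<Rightarrow> real)"
proof (cases k)
  case (Suc j)
  have "Ck_on j {0<..} (\<lambda>x::real. inverse x)"
    by (rule Ck_on_compose[OF _ _ _ Ck_on_inverse]) (auto intro: Ck_on_bounded_linear)
  then show ?thesis unfolding Suc
    by (rule Ck_on_real_SucI[rotated 2]) (auto intro!: derivative_eq_intros simp: inverse_eq_divide)
qed (auto intro!: continuous_intros)

lemma Ck_on_inner_self: "Ck_on k UNIV (\<lambda>x. x \<bullet> x)"
proof (cases k)
  case (Suc j)
  show ?thesis unfolding Suc
  proof (rule Ck_on_SucI)
    show "((\<lambda>x. x \<bullet> x) has_derivative (\<lambda>v. x \<bullet> v + v \<bullet> x)) (at x)" for x :: 'a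
      by (rule derivative_eq_intros refl)+
    show "Ck_on j UNIV (\<lambda>x. x \<bullet> v + v \<bullet> x)" for v :: 'a
      by (intro Ck_on_add Ck_on_bounded_linear bounded_linear_inner_left bounded_linear_inner_right open_UNIV)
  qed simp
qed (auto intro!: continuous_intros)

lemma Ck_on_subset: "Ck_on k U f \<Longrightarrow> V \<subseteq> U \<Longrightarrow> Ck_on k V f"
  by (induction k arbitrary: f) (auto intro: continuous_on_subset)

lemma Ck_on_proj_t: "Ck_on k (- {0}) proj_t"
proof -
  \<comment> \<open>The squared norm is polynomial, so half its logarithm avoids differentiating the
    norm repeatedly.\<close>
  have "Ck_on k (- {0}) (\<lambda>x::real^4. (1/2) * ln (x \<bullet> x))"
    by (intro Ck_on_mult Ck_on_const Ck_on_compose[OF _ _ _ Ck_on_ln] Ck_on_subset[OF Ck_on_inner_self]) auto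
  then show ?thesis
    by (rule Ck_on_cong[rotated 2]) (auto simp: proj_t_def norm_eq_sqrt_inner ln_sqrt)
qed

text \<open>In the chart, a map (t, p) -> (r(t), p) multiplies \<open>x\<close> by exp (r(t) - t) at
  t = \<open>proj_t x\<close>, hence has this form.\<close>

lemma smooth_on_radial:
  assumes "open I" "smooth_on I h"
  shows "smooth_on (cylinder I) (\<lambda>x. h (proj_t x) *\<^sub>R x)"
  unfolding smooth_on_def
proof
  fix k
  have c: "cylinder I \<subseteq> - {0}" by (auto simp: cylinder_def)
  show "Ck_on k (cylinder I) (\<lambda>x. h (proj_t x) *\<^sub>R x)"
  proof (rule Ck_on_scaleR)
    show "Ck_on k (cylinder I) (\<lambda>x. h (proj_t x))"
    proof (rule Ck_on_compose[where f = h and h = proj_t and V = I])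
      show "Ck_on k (cylinder I) proj_t" by (rule Ck_on_subset[OF Ck_on_proj_t c])
    qed (use assms open_cylinder in \<open>auto simp: smooth_on_def cylinder_def proj_t_def\<close>)
  qed (auto intro: Ck_on_bounded_linear bounded_linear_ident open_cylinder assms(1))
qed

section \<open>Smooth inverse functions on an interval\<close>

lemma smooth_on_real_deriv:
  fixes f :: "real \<Rightarrow> real"
  assumes "open I" "smooth_on I f" "\<And>t. t \<in> I \<Longrightarrow> (f has_real_derivative f' t) (at t)"
  shows "smooth_on I f'"
  unfolding smooth_on_def
proof
  fix k
  have "Ck_on k I (\<lambda>t. frechet_derivative f (at t) 1)"
    using assms(2) by (metis Ck_on.simps(2) smooth_on_def)
  moreover have "frechet_derivative f (at t) 1 = f' t" if "t \<in> I" for t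
    by (simp add: frechet_derivative_at[OF assms(3)[OF that, unfolded has_field_derivative_def], symmetric])
  ultimately show "Ck_on k I f'"
    by (rule Ck_on_cong[OF assms(1), rotated])
qed

text \<open>By Rolle's theorem a nowhere vanishing derivative forces injectivity. Smoothness is
  bootstrapped from s' = 1 / r'(s): if s is k times continuously differentiable, so is s', and s
  gains one order.\<close>

lemma smooth_on_inverse_function:
  assumes I: "open I" "is_interval I" and smooth: "smooth_on I r"
    and r: "\<And>t. t \<in> I \<Longrightarrow> (r has_real_derivative r' t) (at t)" and nz: "\<And>t. t \<in> I \<Longrightarrow> r' t \<noteq> 0"
  obtains s where "open (r ` I)" "is_interval (r ` I)" "smooth_on (r ` I) s" "\<And>t. t \<in> I \<Longrightarrow> s (r t) = t"
proof
  have cont: "continuous_on I r"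
    using r by (meson DERIV_isCont continuous_at_imp_continuous_on)
  have less: "r x \<noteq> r y" if xy: "x \<in> I" "y \<in> I" "x < y" for x y
  proof
    assume eq: "r x = r y"
    have sub: "{x..y} \<subseteq> I"
      using I(2) xy by (meson atLeastAtMost_iff mem_is_interval_1_I subsetI)
    have "r differentiable (at z)" if "x < z" "z < y" for z
    proof -
      have "z \<in> I" using sub that by auto
      from r[OF this] show ?thesis unfolding real_differentiable_def by (rule exI)
    qed
    then have "\<exists>z. x < z \<and> z < y \<and> (r has_real_derivative 0) (at z)"
      by (rule Rolle[OF xy(3) eq continuous_on_subset[OF cont sub]])
    then obtain z where z: "x < z" "z < y" "(r has_real_derivative 0) (at z)" by blast
    then have "z \<in> I" using sub by auto
    then show False using z(3) r nz DERIV_unique by blast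
  qed
  then have inj: "inj_on r I"
    by (metis inj_onI linorder_less_linear)
  let ?s = "the_inv_into I r"
  show o: "open (r ` I)"
    using injective_into_1d_imp_open_map_UNIV[OF I(1) cont inj] by simp
  show "is_interval (r ` I)"
    using connected_continuous_image[OF cont] I(2) by (simp add: is_interval_connected_1)
  show s: "?s (r t) = t" if "t \<in> I" for t
    using the_inv_into_f_f[OF inj that] .
  have sI: "?s y \<in> I" "r (?s y) = y" if "y \<in> r ` I" for y
    using that s by auto
  have "(?s has_derivative (\<lambda>v. inverse (r' t) * v)) (at (r t))" if "t \<in> I" for t
    by (rule has_derivative_inverse_strong[OF I(1) that cont s r[OF that, unfolded has_field_derivative_def]])
       (use nz[OF that] in auto)
  then have "(?s has_derivative (\<lambda>v. inverse (r' (?s y)) * v)) (at y)" if "y \<in> r ` I" for y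
    using sI[OF that] by metis
  then have ds: "(?s has_real_derivative inverse (r' (?s y))) (at y)" if "y \<in> r ` I" for y
    using that by (simp add: has_field_derivative_def)
  have "smooth_on I r'" by (rule smooth_on_real_deriv[OF I(1) smooth r])
  then have inv: "Ck_on k I (\<lambda>t. inverse (r' t))" for k
    by (intro Ck_on_compose[OF I(1) _ _ Ck_on_inverse]) (use nz in \<open>auto simp: smooth_on_def\<close>)
  have "Ck_on k (r ` I) ?s" for k
  proof (induction k)
    case 0
    show ?case
      unfolding Ck_on.simps by (intro continuous_at_imp_continuous_on ballI DERIV_isCont[OF ds])
  next
    case (Suc k)
    show ?case
      by (rule Ck_on_real_SucI[OF o ds], assumption)
         (rule Ck_on_compose[where f = "\<lambda>t. inverse (r' t)", OF o I(1) sI(1) inv Suc.IH])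
  qed
  then show "smooth_on (r ` I) ?s" by (simp add: smooth_on_def)
qed

section \<open>Isometries given by a change of the radial coordinate\<close>

lemma proj_t_exp_scaleR: "x \<noteq> 0 \<Longrightarrow> proj_t (exp c *\<^sub>R x) = c + proj_t x"
  by (simp add: proj_t_def ln_mult)

lemma smooth_on_exp_shift:
  assumes "open I" "smooth_on I r"
  shows "smooth_on I (\<lambda>t. exp (r t - t :: real))"
proof -
  have "Ck_on k I (\<lambda>t. exp (r t + - 1 * t))" for k
  proof (rule Ck_on_compose[OF assms(1) open_UNIV _ Ck_on_exp])
    show "Ck_on k I (\<lambda>t. r t + - 1 * t)"
    proof (rule Ck_on_add)
      show "Ck_on k I (\<lambda>t. - 1 * t)"
        using assms(1) by (intro Ck_on_mult Ck_on_const Ck_on_bounded_linear bounded_linear_ident)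
    qed (use assms in \<open>auto simp: smooth_on_def\<close>)
  qed simp
  then show ?thesis by (simp add: smooth_on_def)
qed

text \<open>The map (t, p) -> (r(t), p) pulls the coframe of the sphere back to itself and the
  differential of the model coordinate back to r' dt. Comparing coefficients gives the conditions
  \<open>F\<close>; the model interval is the image of \<open>I\<close>.\<close>

lemma isometric_in_range_biaxial:
  assumes I: "open I" "is_interval I" and smooth: "smooth_on I r"
    and r: "\<And>t. t \<in> I \<Longrightarrow> (r has_real_derivative r' t) (at t)" and nz: "\<And>t. t \<in> I \<Longrightarrow> r' t \<noteq> 0"
    and R: "\<And>t. t \<in> I \<Longrightarrow> r t \<in> R"
    and F: "\<And>t. t \<in> I \<Longrightarrow> F\<^sub>0 (r t) * (r' t)\<^sup>2 = f\<^sub>0 t" "\<And>t. t \<in> I \<Longrightarrow> F\<^sub>1 (r t) = f\<^sub>1 t"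
      "\<And>t. t \<in> I \<Longrightarrow> F\<^sub>2 (r t) = f\<^sub>2 t"
  shows "isometric_in_range I (biaxial f\<^sub>0 f\<^sub>1 f\<^sub>2) R (biaxial F\<^sub>0 F\<^sub>1 F\<^sub>2)"
proof -
  obtain s where s: "open (r ` I)" "is_interval (r ` I)" "smooth_on (r ` I) s" "\<And>t. t \<in> I \<Longrightarrow> s (r t) = t"
    using smooth_on_inverse_function[OF I smooth r nz] by blast
  define \<phi> where "\<phi> x = exp (r (proj_t x) - proj_t x) *\<^sub>R x" for x
  define \<psi> where "\<psi> x = exp (s (proj_t x) - proj_t x) *\<^sub>R x" for x
  have cyl: "x \<noteq> 0" "proj_t x \<in> K" if "x \<in> cylinder K" for x K
    using that by (auto simp: cylinder_def proj_t_def)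
  have cylI: "x \<in> cylinder K" if "x \<noteq> 0" "proj_t x \<in> K" for x K
    using that by (auto simp: cylinder_def proj_t_def)
  have t\<phi>: "proj_t (\<phi> x) = r (proj_t x)" "\<phi> x \<noteq> 0" if "x \<noteq> 0" for x
    using that by (simp_all add: \<phi>_def proj_t_exp_scaleR)
  have t\<psi>: "proj_t (\<psi> x) = s (proj_t x)" "\<psi> x \<noteq> 0" if "x \<noteq> 0" for x
    using that by (simp_all add: \<psi>_def proj_t_exp_scaleR)
  have \<psi>\<phi>: "\<psi> (\<phi> x) = x" if "x \<in> cylinder I" for x
    unfolding \<psi>_def t\<phi>(1)[OF cyl(1)[OF that]] s(4)[OF cyl(2)[OF that]] by (simp add: \<phi>_def flip: exp_add)
  have \<phi>\<psi>: "\<phi> (\<psi> y) = y" "\<psi> y \<in> cylinder I" if y: "y \<in> cylinder (r ` I)" for y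
  proof -
    obtain t where t: "t \<in> I" "proj_t y = r t" using cyl(2)[OF y] by auto
    show "\<psi> y \<in> cylinder I" using t\<psi>[OF cyl(1)[OF y]] t s(4) cylI by simp
    show "\<phi> (\<psi> y) = y"
      unfolding \<phi>_def t\<psi>(1)[OF cyl(1)[OF y]] t(2) s(4)[OF t(1)] by (simp add: \<psi>_def t s(4) flip: exp_add)
  qed
  have "\<phi> ` cylinder I = cylinder (r ` I)"
  proof (intro equalityI subsetI)
    show "y \<in> cylinder (r ` I)" if y: "y \<in> \<phi> ` cylinder I" for y
    proof -
      obtain x where x: "x \<in> cylinder I" "y = \<phi> x" using y by auto
      show ?thesis unfolding x(2)
        by (rule cylI) (use t\<phi>[OF cyl(1)[OF x(1)]] cyl(2)[OF x(1)] in auto)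
    qed
    show "y \<in> \<phi> ` cylinder I" if "y \<in> cylinder (r ` I)" for y
      by (rule image_eqI[where f = \<phi>, OF \<phi>\<psi>(1)[OF that, symmetric] \<phi>\<psi>(2)[OF that]])
  qed
  moreover have "smooth_on (cylinder I) \<phi>" "smooth_on (cylinder (r ` I)) \<psi>"
    unfolding \<phi>_def \<psi>_def
    using smooth_on_radial[OF I(1) smooth_on_exp_shift[OF I(1) smooth]]
      smooth_on_radial[OF s(1) smooth_on_exp_shift[OF s(1,3)]] by simp_all
  ultimately have diffeo: "diffeomorphism (cylinder I) (cylinder (r ` I)) \<phi>"
    using \<psi>\<phi> unfolding diffeomorphism_def by blast
  have iso: "biaxial F\<^sub>0 F\<^sub>1 F\<^sub>2 (\<phi> x) (frechet_derivative \<phi> (at x) u) (frechet_derivative \<phi> (at x) v)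
      = biaxial f\<^sub>0 f\<^sub>1 f\<^sub>2 x u v" if x: "x \<in> cylinder I" for x u v
  proof -
    define t N c where "t = proj_t x" and "N = (norm x)\<^sup>2" and "c = exp (r t - t)"
    have x0: "x \<noteq> 0" and tI: "t \<in> I" using cyl[OF x] by (simp_all add: t_def)
    have N0: "N \<noteq> 0" "c \<noteq> 0" using x0 by (simp_all add: N_def c_def)
    have "((\<lambda>s. exp (r s - s)) has_real_derivative c * (r' t - 1)) (at t)"
      unfolding c_def by (auto intro!: derivative_eq_intros r[OF tI])
    then have "((\<lambda>x. exp (r (proj_t x) - proj_t x)) has_derivative (\<lambda>v. (c * (r' t - 1)) * ((x \<bullet> v) / (norm x)\<^sup>2))) (at x)"
      unfolding t_def by (rule has_derivative_comp_proj_t[OF x0])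
    from has_derivative_scaleR[OF this has_derivative_ident]
    have "(\<phi> has_derivative (\<lambda>v. c *\<^sub>R v + ((c * (r' t - 1)) * ((x \<bullet> v) / N)) *\<^sub>R x)) (at x)"
      unfolding \<phi>_def[abs_def] c_def t_def N_def .
    then have D: "frechet_derivative \<phi> (at x) v = c *\<^sub>R v + ((c * (r' t - 1)) * ((x \<bullet> v) / N)) *\<^sub>R x" for v
      by (simp add: frechet_derivative_at[symmetric])
    have \<phi>x: "\<phi> x = c *\<^sub>R x" by (simp add: \<phi>_def c_def t_def)
    have N\<phi>: "(norm (\<phi> x))\<^sup>2 = c\<^sup>2 * N" by (simp add: \<phi>x N_def power_mult_distrib)
    have xx: "x \<bullet> x = N" by (simp add: N_def power2_norm_eq_inner)
    have dt: "dt (\<phi> x) (frechet_derivative \<phi> (at x) v) = r' t * dt x v" for v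
      unfolding dt_eq[OF t\<phi>(2)[OF x0]] dt_eq[OF x0] D N\<phi> N_def[symmetric] unfolding \<phi>x
      using N0 by (simp add: inner_add_right xx field_simps power2_eq_square)
    \<comment> \<open>The part of the derivative along \<open>x\<close> is annihilated, because
      \<open>quat_mult a x\<close> is orthogonal to \<open>x\<close>, and the powers of
      \<open>c\<close> cancel.\<close>
    have co: "coframe a (\<phi> x) (frechet_derivative \<phi> (at x) v) = coframe a x v" for a v
      unfolding coframe_eq[OF t\<phi>(2)[OF x0]] coframe_eq[OF x0] D N\<phi> N_def[symmetric] unfolding \<phi>x
      using N0 by (simp add: inner_add_right quat_mult_scaleR quat_mult_self field_simps power2_eq_square)
    show ?thesis
      unfolding biaxial_def dt co t\<phi>(1)[OF x0] t_def[symmetric]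
      using F[OF tI] by (simp add: power2_eq_square algebra_simps flip: F(1)[OF tI])
  qed
  show ?thesis unfolding isometric_in_range_def isometric_def
    using s(1,2) R diffeo iso by blast
qed

section \<open>The two explicit families\<close>

lemma smooth_on_real_antideriv:
  fixes f :: "real \<Rightarrow> real"
  assumes "open I" "\<And>t. t \<in> I \<Longrightarrow> (f has_real_derivative f' t) (at t)" "smooth_on I f'"
  shows "smooth_on I f"
  unfolding smooth_on_def
proof
  fix k
  have "Ck_on (Suc k) I f"
    by (rule Ck_on_real_SucI[OF assms(1,2)]) (use assms(3) in \<open>auto simp: smooth_on_def\<close>)
  then show "Ck_on k I f" by (rule Ck_on_SucD)
qed

lemma constant_on_interval:
  fixes f :: "real \<Rightarrow> real"
  assumes "is_interval I" "\<And>t. t \<in> I \<Longrightarrow> (f has_real_derivative 0) (at t)" "s \<in> I" "t \<in> I"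
  shows "f s = f t"
  using has_field_derivative_zero_constant[of I f] assms
  by (metis has_field_derivative_at_within is_interval_convex)

text \<open>The sign of the first integral decides which of \<open>a\<close>, \<open>b\<close> is
  larger and whether Taub-NUT or its negative appears; its absolute value determines
  \<open>m\<close>.\<close>

lemma taub_nut_case:
  fixes a b :: "real \<Rightarrow> real" and \<epsilon> :: real
  assumes I: "open I" "is_interval I" and smooth: "smooth_on I a"
    and pos: "\<And>t. t \<in> I \<Longrightarrow> a t > 0" "\<And>t. t \<in> I \<Longrightarrow> b t > 0"
    and \<epsilon>: "\<epsilon>\<^sup>2 = 1"
    and a: "\<And>t. t \<in> I \<Longrightarrow> (a has_real_derivative \<epsilon> * (a t / b t)\<^sup>2) (at t)"
    and b: "\<And>t. t \<in> I \<Longrightarrow> (b has_real_derivative \<epsilon> * (2 - a t / b t)) (at t)"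
    and ne: "t\<^sub>0 \<in> I" "a t\<^sub>0 \<noteq> b t\<^sub>0"
    and g: "g = biaxial (\<lambda>t. 1) (\<lambda>t. (a t)\<^sup>2) (\<lambda>t. (b t)\<^sup>2)"
  shows "(\<forall>t\<in>I. a t < b t) \<and> (\<exists>m>0. isometric_in_range I g {m<..} (taub_nut m)) \<or>
    (\<forall>t\<in>I. a t > b t) \<and> (\<exists>m>0. isometric_in_range I g {-m<..<m} (\<lambda>x u v. - taub_nut m x u v))"
proof -
  let ?c = "\<lambda>t. (1 - a t / b t) / (a t)\<^sup>2"
  have nz: "a t \<noteq> 0" "b t \<noteq> 0" if "t \<in> I" for t using pos[OF that] by auto
  \<comment> \<open>With y = a / b, both 1 - y and a^2 satisfy f' = (2 \<epsilon> y / b) f, so their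
    quotient is constant.\<close>
  have c': "(?c has_real_derivative 0) (at t)" if t: "t \<in> I" for t
    using nz[OF t] by (auto intro!: derivative_eq_intros a[OF t] b[OF t]
      simp: field_simps power2_eq_square)
  define c where "c = ?c t\<^sub>0"
  have c: "1 - a t / b t = c * (a t)\<^sup>2" if t: "t \<in> I" for t
    using constant_on_interval[OF I(2) c' t ne(1)] nz[OF t] by (simp add: c_def field_simps)
  have c0: "c \<noteq> 0" using ne nz[OF ne(1)] by (simp add: c_def)
  \<comment> \<open>Chosen so that the first integral equals \<open>\<sigma> / m^2\<close>; carrying
    the sign \<sigma> along treats both ranges of the coordinate at once.\<close>
  define m \<sigma> where "m = 1 / sqrt \<bar>c\<bar>" and "\<sigma> = sgn c"
  have m: "m > 0" "m\<^sup>2 = 1 / \<bar>c\<bar>" using c0 by (simp_all add: m_def power_divide)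
  have \<sigma>: "\<sigma> * \<sigma> = 1" "\<sigma> * \<bar>c\<bar> = c" using c0 by (auto simp: \<sigma>_def sgn_if)
  have my: "m\<^sup>2 * (1 - a t / b t) = \<sigma> * (a t)\<^sup>2" if t: "t \<in> I" for t
    unfolding c[OF t] m(2) using c0 by (simp add: \<sigma>_def sgn_div_norm field_simps)
  have key: "m\<^sup>2 * (b t - a t) = \<sigma> * (a t)\<^sup>2 * b t" if t: "t \<in> I" for t
    using my[OF t] nz[OF t] by (simp add: field_simps)
  \<comment> \<open>In the Taub-NUT metric the coefficients of (e^1)^2 and (e^2)^2 have quotient (2
    m / (r + m))^2. Equating this with (a / b)^2 and solving for r, with r + m positive, gives the
    coordinate.\<close>
  let ?r = "\<lambda>t. 2 * m * (b t / a t) - m"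
  have r: "(?r has_real_derivative 4 * \<epsilon> * \<sigma> * a t / m) (at t)" if t: "t \<in> I" for t
  proof -
    have "(?r has_real_derivative 2 * m * ((\<epsilon> * (2 - a t / b t) * a t - b t * (\<epsilon> * (a t / b t)\<^sup>2)) / (a t * a t))) (at t)"
      by (rule derivative_eq_intros a[OF t] b[OF t] refl nz[OF t])+ (use nz[OF t] in simp)
    moreover have "2 * m * ((\<epsilon> * (2 - a t / b t) * a t - b t * (\<epsilon> * (a t / b t)\<^sup>2)) / (a t * a t))
        = 4 * \<epsilon> * (m\<^sup>2 * (1 - a t / b t)) / (m * a t)"
      using nz[OF t] m(1) by (simp add: field_simps power2_eq_square)
    also have "\<dots> = 4 * \<epsilon> * \<sigma> * a t / m"
      unfolding my[OF t] using nz[OF t] by (simp add: power2_eq_square)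
    ultimately show ?thesis by simp
  qed
  \<comment> \<open>By the first integral the derivative of \<open>?r\<close> is a constant multiple
    of \<open>a\<close>, so its smoothness is inherited from \<open>a\<close>.\<close>
  have sr: "smooth_on I ?r"
  proof (rule smooth_on_real_antideriv[OF I(1) r], assumption)
    have "Ck_on k I (\<lambda>t. (4 * \<epsilon> * \<sigma> / m) * a t)" for k
      using smooth I(1) by (intro Ck_on_mult Ck_on_const) (auto simp: smooth_on_def)
    then show "smooth_on I (\<lambda>t. 4 * \<epsilon> * \<sigma> * a t / m)"
      by (simp add: smooth_on_def)
  qed
  have e0: "\<epsilon> \<noteq> 0" "\<sigma> \<noteq> 0" using \<epsilon> \<sigma> by auto
  have iso: "isometric_in_range I g R (biaxial (\<lambda>r. \<sigma> * ((r + m) / (16 * (r - m))))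
     (\<lambda>r. \<sigma> * (m\<^sup>2 * (r - m) / (r + m))) (\<lambda>r. \<sigma> * ((r\<^sup>2 - m\<^sup>2) / 4)))"
    if R: "\<And>t. t \<in> I \<Longrightarrow> ?r t \<in> R" for R
    unfolding g
  proof (rule isometric_in_range_biaxial[OF I sr r _ R])
    fix t assume t: "t \<in> I"
    have ab: "b t - a t \<noteq> 0"
      using key[OF t] e0 nz[OF t] by auto
    have rm: "?r t - m = 2 * m * ((b t - a t) / a t)" "?r t + m = 2 * m * (b t / a t)"
      using nz[OF t] by (simp_all add: field_simps)
    show "4 * \<epsilon> * \<sigma> * a t / m \<noteq> 0" using e0 nz[OF t] m(1) by simp
    have "\<sigma> * ((?r t + m) / (16 * (?r t - m))) * (4 * \<epsilon> * \<sigma> * a t / m)\<^sup>2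
        = \<epsilon>\<^sup>2 * (\<sigma> * \<sigma>) * (\<sigma> * (a t)\<^sup>2 * b t) / (m\<^sup>2 * (b t - a t))"
      unfolding rm using nz[OF t] m(1) ab by (simp add: field_simps power2_eq_square)
    also have "\<dots> = 1" unfolding key[OF t, symmetric] \<epsilon> \<sigma> using m(1) ab by simp
    finally show "\<sigma> * ((?r t + m) / (16 * (?r t - m))) * (4 * \<epsilon> * \<sigma> * a t / m)\<^sup>2 = 1" .
    have "\<sigma> * (m\<^sup>2 * (?r t - m) / (?r t + m)) = \<sigma> * (m\<^sup>2 * (b t - a t)) / b t"
      unfolding rm using nz[OF t] m(1) by (simp add: field_simps)
    also have "\<dots> = (\<sigma> * \<sigma>) * (a t)\<^sup>2" unfolding key[OF t] using nz[OF t] by simp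
    finally show "\<sigma> * (m\<^sup>2 * (?r t - m) / (?r t + m)) = (a t)\<^sup>2" by (simp add: \<sigma>)
    have "(?r t)\<^sup>2 - m\<^sup>2 = (?r t - m) * (?r t + m)" by algebra
    then have "\<sigma> * (((?r t)\<^sup>2 - m\<^sup>2) / 4) = \<sigma> * (m\<^sup>2 * (b t - a t)) * b t / (a t)\<^sup>2"
      unfolding rm using nz[OF t] by (simp add: field_simps power2_eq_square)
    also have "\<dots> = (\<sigma> * \<sigma>) * (b t)\<^sup>2" unfolding key[OF t] using nz[OF t] by (simp add: power2_eq_square)
    finally show "\<sigma> * (((?r t)\<^sup>2 - m\<^sup>2) / 4) = (b t)\<^sup>2" by (simp add: \<sigma>)
  qed
  show ?thesis
  proof (cases "c > 0")
    case True
    then have s: "\<sigma> = 1" by (simp add: \<sigma>_def)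
    have lt: "a t < b t" if t: "t \<in> I" for t
    proof -
      have "m\<^sup>2 * (b t - a t) > 0" unfolding key[OF t] s using pos[OF t] by simp
      then show ?thesis by (simp add: zero_less_mult_iff)
    qed
    have "?r t \<in> {m<..}" if t: "t \<in> I" for t
      using lt[OF t] pos[OF t] m(1) by (simp add: field_simps)
    from iso[OF this] lt m(1) show ?thesis by (auto simp: s taub_nut_def)
  next
    case False
    then have s: "\<sigma> = -1" using c0 by (simp add: \<sigma>_def)
    have lt: "b t < a t" if t: "t \<in> I" for t
    proof -
      have "m\<^sup>2 * (b t - a t) < 0" unfolding key[OF t] s using pos[OF t] by simp
      then show ?thesis by (simp add: mult_less_0_iff)
    qed
    have "?r t \<in> {-m<..<m}" if t: "t \<in> I" for t
      using lt[OF t] pos[OF t] m(1) by (simp add: field_simps)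
    moreover have "biaxial (\<lambda>r. - f r) (\<lambda>r. - h r) (\<lambda>r. - k r) = (\<lambda>x u v. - biaxial f h k x u v)" for f h k
      by (intro ext) (simp add: biaxial_def algebra_simps)
    ultimately have "isometric_in_range I g {-m<..<m} (\<lambda>x u v. - taub_nut m x u v)"
      using iso[of "{-m<..<m}"] unfolding s taub_nut_def by (simp only: mult_minus1)
    then show ?thesis using lt m(1) by blast
  qed
qed

text \<open>The coefficient of (e^2)^2 in the model is r^2, so the coordinate must be r = b. Since
  (dr/dt)^2 = (a / b)^2, the coefficients of dr^2 and (e^1)^2 then both match once 1 - q / b^4 = (a
  / b)^2.\<close>

lemma eguchi_hanson_case:
  fixes a b :: "real \<Rightarrow> real" and \<epsilon> :: real
  assumes I: "open I" "is_interval I" and smooth: "smooth_on I b"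
    and pos: "\<And>t. t \<in> I \<Longrightarrow> a t > 0" "\<And>t. t \<in> I \<Longrightarrow> b t > 0"
    and \<epsilon>: "\<epsilon>\<^sup>2 = 1"
    and a: "\<And>t. t \<in> I \<Longrightarrow> (a has_real_derivative \<epsilon> * ((a t / b t)\<^sup>2 - 2)) (at t)"
    and b: "\<And>t. t \<in> I \<Longrightarrow> (b has_real_derivative - \<epsilon> * (a t / b t)) (at t)"
    and ne: "t\<^sub>0 \<in> I" "a t\<^sub>0 \<noteq> b t\<^sub>0"
    and g: "g = biaxial (\<lambda>t. 1) (\<lambda>t. (a t)\<^sup>2) (\<lambda>t. (b t)\<^sup>2)"
  shows "(\<forall>t\<in>I. a t < b t) \<and> (\<exists>c>0. isometric_in_range I g {c<..} (eguchi_hanson c)) \<or>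
    (\<forall>t\<in>I. a t > b t) \<and> (\<exists>q<0. isometric_in_range I g {0<..} (eguchi_hanson_pow4 q))"
proof -
  \<comment> \<open>Solving a^2 = r^2 (1 - q / r^4) at r = b for q gives this expression, which the
    system keeps constant.\<close>
  let ?q = "\<lambda>t. b t ^ 4 - (a t)\<^sup>2 * (b t)\<^sup>2"
  have nz: "a t \<noteq> 0" "b t \<noteq> 0" if "t \<in> I" for t using pos[OF that] by auto
  have q': "(?q has_real_derivative 0) (at t)" if t: "t \<in> I" for t
    using nz[OF t] by (auto intro!: derivative_eq_intros a[OF t] b[OF t]
      simp: field_simps power2_eq_square power3_eq_cube)
  define q where "q = ?q t\<^sub>0"
  have q: "b t ^ 4 - q = (a t)\<^sup>2 * (b t)\<^sup>2" if t: "t \<in> I" for t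
    using constant_on_interval[OF I(2) q' t ne(1)] by (simp add: q_def)
  \<comment> \<open>Shows that \<open>q\<close> has the sign of \<open>b t - a t\<close>, so the
    order of \<open>a\<close> and \<open>b\<close> is the same on all of \<open>I\<close>.\<close>
  have qf: "q = (b t)\<^sup>2 * (b t + a t) * (b t - a t)" if t: "t \<in> I" for t
    using q[OF t] by algebra
  have q0: "q \<noteq> 0"
    using qf[OF ne(1)] ne pos[OF ne(1)] by simp
  have e0: "\<epsilon> \<noteq> 0" using \<epsilon> by auto
  have iso: "isometric_in_range I g R (eguchi_hanson_pow4 q)" if R: "\<And>t. t \<in> I \<Longrightarrow> b t \<in> R" for R
    unfolding g eguchi_hanson_pow4_def
  proof (rule isometric_in_range_biaxial[OF I smooth b _ R])
    fix t assume t: "t \<in> I"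
    have f: "1 - q / b t ^ 4 = (a t / b t)\<^sup>2"
    proof -
      have "1 - q / b t ^ 4 = (b t ^ 4 - q) / b t ^ 4" using nz[OF t] by (simp add: diff_divide_distrib)
      then show ?thesis unfolding q[OF t] using nz[OF t] by (simp add: field_simps power2_eq_square power4_eq_xxxx)
    qed
    show "- \<epsilon> * (a t / b t) \<noteq> 0" using e0 nz[OF t] by simp
    show "inverse (1 - q / b t ^ 4) * (- \<epsilon> * (a t / b t))\<^sup>2 = 1"
      unfolding f using nz[OF t] \<epsilon> by (simp add: power_mult_distrib power_divide)
    show "(b t)\<^sup>2 * (1 - q / b t ^ 4) = (a t)\<^sup>2"
      unfolding f using nz[OF t] by (simp add: power_divide)
  qed auto
  show ?thesis
  proof (cases "q > 0")
    case True
    \<comment> \<open>A positive \<open>q\<close> is the fourth power of a real parameter. The bound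
      \<open>b t > c\<close> holds because \<open>b t ^ 4 - q\<close> is the product of two squares
      of nonzero numbers.\<close>
    define c where "c = root 4 q"
    have c: "c > 0" "c ^ 4 = q" using True by (simp_all add: c_def)
    have "a t < b t" if t: "t \<in> I" for t
    proof -
      have "0 < (b t)\<^sup>2 * (b t + a t)" using pos[OF t] by simp
      moreover have "0 < (b t)\<^sup>2 * (b t + a t) * (b t - a t)" using True qf[OF t] by (rule subst[rotated])
      ultimately have "0 < b t - a t" by (rule zero_less_mult_pos[rotated])
      then show ?thesis by simp
    qed
    moreover have "b t \<in> {c<..}" if t: "t \<in> I" for t
    proof -
      have "b t ^ 4 - q > 0" using q[OF t] nz[OF t] by simp
      then have "c ^ 4 < b t ^ 4" using c by simp
      then show ?thesis using pos(2)[OF t] power_less_imp_less_base by fastforce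
    qed
    ultimately show ?thesis using iso[of "{c<..}"] c by (auto simp: eguchi_hanson_def)
  next
    case False
    then have "q < 0" using q0 by simp
    moreover have "b t < a t" if t: "t \<in> I" for t
    proof -
      have "0 < (b t)\<^sup>2 * (b t + a t)" using pos[OF t] by simp
      moreover have "(b t)\<^sup>2 * (b t + a t) * (b t - a t) < 0" using \<open>q < 0\<close> qf[OF t] by (rule subst[rotated])
      ultimately have "b t - a t < 0" using mult_less_cancel_left_pos[of "(b t)\<^sup>2 * (b t + a t)" "b t - a t" 0] by simp
      then show ?thesis by simp
    qed
    ultimately show ?thesis using \<open>q < 0\<close> iso[of "{0<..}"] pos by auto
  qed
qed

section \<open>Classification of the coefficients and identification of the metrics\<close>

theorem theorem1:
  fixes I :: "real set" and A\<^sub>1 A\<^sub>2 :: "real \<Rightarrow> real"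
    and k\<^sub>1 k\<^sub>2 k\<^sub>3 l\<^sub>1 l\<^sub>2 l\<^sub>3 :: real and g :: "4 metric"
  assumes "open I" and "is_interval I"
    and "smooth_on I A\<^sub>1" and "smooth_on I A\<^sub>2"
    and "\<forall>t\<in>I. A\<^sub>1 t > 0" and "\<forall>t\<in>I. A\<^sub>2 t > 0"
    and "g = biaxial (\<lambda>t. 1) (\<lambda>t. (A\<^sub>1 t)\<^sup>2) (\<lambda>t. (A\<^sub>2 t)\<^sup>2)"
    and "ricci_flat_on (cylinder I) g"
    and "\<exists>t\<in>I. A\<^sub>1 t \<noteq> A\<^sub>2 t"
    and "\<forall>t\<in>I. deriv A\<^sub>1 t = k\<^sub>1 * (A\<^sub>1 t / A\<^sub>2 t)\<^sup>2 + k\<^sub>2 * (A\<^sub>1 t / A\<^sub>2 t) + k\<^sub>3"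
    and "\<forall>t\<in>I. deriv A\<^sub>2 t = l\<^sub>1 * (A\<^sub>1 t / A\<^sub>2 t)\<^sup>2 + l\<^sub>2 * (A\<^sub>1 t / A\<^sub>2 t) + l\<^sub>3"
  shows "\<exists>\<epsilon>\<in>{1, -1}.
     (\<epsilon> * k\<^sub>1 = 1 \<and> \<epsilon> * k\<^sub>2 = 0 \<and> \<epsilon> * k\<^sub>3 = 0 \<and> \<epsilon> * l\<^sub>1 = 0 \<and> \<epsilon> * l\<^sub>2 = -1 \<and> \<epsilon> * l\<^sub>3 = 2 \<and>
       ((\<forall>t\<in>I. A\<^sub>1 t < A\<^sub>2 t) \<and> (\<exists>m>0. isometric_in_range I g {m<..} (taub_nut m)) \<or>
        (\<forall>t\<in>I. A\<^sub>1 t > A\<^sub>2 t) \<and>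
          (\<exists>m>0. isometric_in_range I g {-m<..<m} (\<lambda>x u v. - taub_nut m x u v)))) \<or>
     (\<epsilon> * k\<^sub>1 = 1 \<and> \<epsilon> * k\<^sub>2 = 0 \<and> \<epsilon> * k\<^sub>3 = -2 \<and> \<epsilon> * l\<^sub>1 = 0 \<and> \<epsilon> * l\<^sub>2 = -1 \<and> \<epsilon> * l\<^sub>3 = 0 \<and>
       ((\<forall>t\<in>I. A\<^sub>1 t < A\<^sub>2 t) \<and> (\<exists>a>0. isometric_in_range I g {a<..} (eguchi_hanson a)) \<or>
        (\<forall>t\<in>I. A\<^sub>1 t > A\<^sub>2 t) \<and>
          (\<exists>q<0. isometric_in_range I g {0<..} (eguchi_hanson_pow4 q)))) \<or>
     (\<epsilon> * k\<^sub>1 = 1 \<and> \<epsilon> * k\<^sub>2 = 0 \<and> \<epsilon> * k\<^sub>3 = 0 \<and> \<epsilon> * l\<^sub>1 = 0 \<and> \<epsilon> * l\<^sub>2 = -1 \<and> \<epsilon> * l\<^sub>3 = -2)"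
proof -
  have diff: "(f has_real_derivative deriv f t) (at t)" if "smooth_on I f" "t \<in> I" for f t
    using that Ck_on.simps(2)[of 0 I f] by (simp add: smooth_on_def DERIV_deriv_iff_real_differentiable del: Ck_on.simps)
  have a: "(A\<^sub>1 has_real_derivative k\<^sub>1 * (A\<^sub>1 t / A\<^sub>2 t)\<^sup>2 + k\<^sub>2 * (A\<^sub>1 t / A\<^sub>2 t) + k\<^sub>3) (at t)"
    and b: "(A\<^sub>2 has_real_derivative l\<^sub>1 * (A\<^sub>1 t / A\<^sub>2 t)\<^sup>2 + l\<^sub>2 * (A\<^sub>1 t / A\<^sub>2 t) + l\<^sub>3) (at t)" if "t \<in> I" for t
    using diff[OF assms(3) that] diff[OF assms(4) that] assms(10,11) that by simp_all
  have pos: "A\<^sub>1 t > 0" "A\<^sub>2 t > 0" if "t \<in> I" for t using assms(5,6) that by auto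
  obtain t\<^sub>0 where ne: "t\<^sub>0 \<in> I" "A\<^sub>1 t\<^sub>0 \<noteq> A\<^sub>2 t\<^sub>0" using assms(9) by blast
  note C = biaxial_ricci_flat_coefficients[OF assms(1,2) a b pos assms(8)[unfolded assms(7)] ne]
  \<comment> \<open>The sign \<epsilon> of the conclusion will be \<open>k\<^sub>1\<close> itself,
    which is its own inverse.\<close>
  have sgn: "k\<^sub>1 \<in> {1, -1}" using C(1) by (simp add: power2_eq_1_iff)
  have kk: "k\<^sub>1 * k\<^sub>1 = 1" "k\<^sub>1\<^sup>2 = 1" using C(1) by (simp_all add: power2_eq_square)
  have mk: "z = k\<^sub>1 * (k\<^sub>1 * z)" for z using kk by (simp flip: mult.assoc)
  \<comment> \<open>\<open>k\<^sub>3 * l\<^sub>3 = 0\<close> leaves two branches. If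
    \<open>k\<^sub>3 = 0\<close>, the last relation reads
    \<open>(k\<^sub>1 * l\<^sub>3)^2 = 4\<close> and splits by sign; if
    \<open>l\<^sub>3 = 0\<close>, it determines \<open>k\<^sub>1 * k\<^sub>3\<close>.\<close>
  consider (TN) "k\<^sub>3 = 0" "k\<^sub>1 * l\<^sub>3 = 2" | (EH) "k\<^sub>1 * k\<^sub>3 = -2" "l\<^sub>3 = 0" | (neg) "k\<^sub>3 = 0" "k\<^sub>1 * l\<^sub>3 = -2"
  proof -
    have "l\<^sub>3 = 0 \<or> k\<^sub>3 = 0" using C(5) by auto
    moreover have "k\<^sub>1 * l\<^sub>3 = 2 \<or> k\<^sub>1 * l\<^sub>3 = -2" if "k\<^sub>3 = 0"
    proof -
      have "(k\<^sub>1 * l\<^sub>3)\<^sup>2 = 2\<^sup>2" using C(6) that kk by (simp add: power_mult_distrib)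
      then show ?thesis by (simp only: power2_eq_iff)
    qed
    moreover have "k\<^sub>1 * k\<^sub>3 = -2" if "l\<^sub>3 = 0" using C(6) that by simp
    ultimately show thesis using that by blast
  qed
  then show ?thesis
  proof cases
    case TN
    have a': "(A\<^sub>1 has_real_derivative k\<^sub>1 * (A\<^sub>1 t / A\<^sub>2 t)\<^sup>2) (at t)"
      and b': "(A\<^sub>2 has_real_derivative k\<^sub>1 * (2 - A\<^sub>1 t / A\<^sub>2 t)) (at t)" if "t \<in> I" for t
      using a[OF that] b[OF that] mk[of l\<^sub>3] TN C by (simp_all add: algebra_simps)
    note D = taub_nut_case[OF assms(1-3) pos kk(2) a' b' ne assms(7)]
    show ?thesis
      by (rule bexI[OF _ sgn], rule disjI1, intro conjI) (rule D | use TN C kk in simp)+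
  next
    case EH
    have a': "(A\<^sub>1 has_real_derivative k\<^sub>1 * ((A\<^sub>1 t / A\<^sub>2 t)\<^sup>2 - 2)) (at t)"
      and b': "(A\<^sub>2 has_real_derivative - k\<^sub>1 * (A\<^sub>1 t / A\<^sub>2 t)) (at t)" if "t \<in> I" for t
      using a[OF that] b[OF that] mk[of k\<^sub>3] EH C by (simp_all add: algebra_simps)
    note D = eguchi_hanson_case[OF assms(1,2,4) pos kk(2) a' b' ne assms(7)]
    show ?thesis
      by (rule bexI[OF _ sgn], rule disjI2, rule disjI1, intro conjI) (rule D | use EH C kk in simp)+
  next
    \<comment> \<open>This alternative asserts only the values of the constants.\<close>
    case neg
    then show ?thesis using C kk by (intro bexI[OF _ sgn] disjI2 conjI) simp_all
  qed
qed

end
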